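(* Let $(\pi_t)_{t\ge0}$ be the oriented swap process on the half line. For $t\ge0$ define $$\tau(t)=\inf\{s>0:\ \pi_t^{-1}(1)<\pi_{t+s}^{-1}(1)\}.$$ Let $\mathcal{G}$ be the absolute value of a Gaussian random variable with mean $0$ and variance $2$. Then $$\frac{\tau(t)}{\sqrt t}\ \longrightarrow\ \mathcal{G}\quad\text{in distribution as } t\to\infty.$$
   Context: Oriented swap process on the half line: particles labelled by $\mathbb{Z}^+=\{1,2,\dots\}$ occupy the positions $\mathbb{Z}^+$, one per position. At time $0$ particle $i$ is at position $i$ for all $i$. For each $i\ge 1$ there is an independent rate-$1$ Poisson process on $\mathbb{R}^+$ attached to the pair of positions $(i,i+1)$. When it rings, the particles at positions $i$ and $i+1$ exchange positions if the label of the particle at position $i$ is smaller than the label of the particle at position $i+1$; otherwise nothing happens. The process is well defined almost surely by the Harris graphical construction: for a fixed time $t$, almost surely infinitely many pairs $(i,i+1)$ have no ring up to time $t$, so that the half line splits into finite segments evolving separately. $\pi_t(i)$ denotes the position at time $t$ of the particle with label $i$, and $\pi_t^{-1}(i)$ denotes the label of the particle which is at position $i$ at time $t$. *)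

theory Defs
  imports "HOL-Probability.Probability"
begin

section \<open>Poisson processes\<close>

text \<open>
  A Poisson process of the given rate is represented by its counting function: \<open>N t \<omega>\<close> is the
  number of rings in the time interval \<open>(0,t]\<close>. Only times \<open>t \<ge> 0\<close> matter.
  The subtraction of natural numbers in the increments is harmless since the paths are
  nondecreasing. A finite time grid is given as an initial part of a monotone sequence.
\<close>

definition poisson_process :: "'a measure \<Rightarrow> real \<Rightarrow> (real \<Rightarrow> 'a \<Rightarrow> nat) \<Rightarrow> bool" where
  "poisson_process M rate N \<longleftrightarrow>
     (\<forall>t\<ge>0. N t \<in> M \<rightarrow>\<^sub>M count_space UNIV) \<and>
     (\<forall>\<omega>\<in>space M. N 0 \<omega> = 0 \<and> mono_on {0..} (\<lambda>t. N t \<omega>) \<and>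
        (\<forall>t\<ge>0. ((\<lambda>u. N u \<omega>) \<longlongrightarrow> N t \<omega>) (at_right t))) \<and>
     (\<forall>(t::nat \<Rightarrow> real) n. 0 \<le> t 0 \<and> mono t \<longrightarrow>
        prob_space.indep_vars M (\<lambda>_. count_space UNIV)
          (\<lambda>k \<omega>. N (t (Suc k)) \<omega> - N (t k) \<omega>) {..<n}) \<and>
     (\<forall>s t. 0 \<le> s \<and> s < t \<longrightarrow>
        distr M (count_space UNIV) (\<lambda>\<omega>. N t \<omega> - N s \<omega>) =
          measure_pmf (poisson_pmf (rate * (t - s))))"

text \<open>Independence of processes: their restrictions to \<open>[0,\<infinity>)\<close> are independent as random
  elements of the path space with its product sigma-algebra.\<close>

definition indep_processes ::
    "'a measure \<Rightarrow> ('i \<Rightarrow> real \<Rightarrow> 'a \<Rightarrow> nat) \<Rightarrow> 'i set \<Rightarrow> bool" where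
  "indep_processes M N I \<longleftrightarrow>
     prob_space.indep_vars M (\<lambda>_. PiM {0..} (\<lambda>_. count_space UNIV))
       (\<lambda>i \<omega>. \<lambda>t\<in>{0..}. N i t \<omega>) I"

definition rings :: "(real \<Rightarrow> 'a \<Rightarrow> nat) \<Rightarrow> 'a \<Rightarrow> real \<Rightarrow> bool" where
  "rings N \<omega> s \<longleftrightarrow> 0 < s \<and> (\<forall>r. 0 \<le> r \<and> r < s \<longrightarrow> N r \<omega> < N s \<omega>)"


section \<open>The oriented swap process\<close>

text \<open>
  A configuration \<open>\<eta> :: nat \<Rightarrow> nat\<close> maps a position to the label of the particle there, i.e.\ it
  is \<open>\<pi>\<^sub>t\<close> inverse. Positions and labels are the positive integers; index \<open>0\<close> is never touched.
\<close>

definition oswap :: "nat \<Rightarrow> (nat \<Rightarrow> nat) \<Rightarrow> (nat \<Rightarrow> nat)" where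
  "oswap i \<eta> = (if \<eta> i < \<eta> (Suc i) then \<eta>(i := \<eta> (Suc i), Suc i := \<eta> i) else \<eta>)"

text \<open>
  The pairs \<open>(i, i+1)\<close> within \<open>{1..n}\<close> that ring during \<open>(0,t]\<close>, in chronological order.
  Simultaneous rings have probability zero; they are listed in increasing order of \<open>i\<close>.
\<close>

definition ring_word :: "(nat \<Rightarrow> real \<Rightarrow> 'a \<Rightarrow> nat) \<Rightarrow> 'a \<Rightarrow> nat \<Rightarrow> real \<Rightarrow> nat list" where
  "ring_word N \<omega> n t =
     concat (map (\<lambda>s. sorted_list_of_set {i\<in>{1..<n}. rings (N i) \<omega> s})
       (sorted_list_of_set {s. s \<le> t \<and> (\<exists>i\<in>{1..<n}. rings (N i) \<omega> s)}))"

definition finite_osp :: "(nat \<Rightarrow> real \<Rightarrow> 'a \<Rightarrow> nat) \<Rightarrow> nat \<Rightarrow> real \<Rightarrow> 'a \<Rightarrow> nat \<Rightarrow> nat" where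
  "finite_osp N n t \<omega> = fold oswap (ring_word N \<omega> n t) id"

text \<open>
  Harris construction: \<open>osp_label N t \<omega> x\<close> is the label of the particle at position \<open>x \<ge> 1\<close> at
  time \<open>t\<close>. If \<open>n \<ge> x\<close> is such that the pair \<open>(n, n+1)\<close> has not rung up to time \<open>t\<close>, then
  nothing has crossed from \<open>{1..n}\<close> to its complement, and the label is the one seen in the system
  on \<open>{1..n}\<close>, whichever such \<open>n\<close> is used. Almost surely such an \<open>n\<close> exists for all \<open>t\<close> and \<open>x\<close>;
  otherwise the \<open>LEAST\<close> is some fixed junk value.
\<close>

definition osp_label :: "(nat \<Rightarrow> real \<Rightarrow> 'a \<Rightarrow> nat) \<Rightarrow> real \<Rightarrow> 'a \<Rightarrow> nat \<Rightarrow> nat" where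
  "osp_label N t \<omega> x = finite_osp N (LEAST n. x \<le> n \<and> N n t \<omega> = 0) t \<omega> x"

text \<open>The infimum is taken in the extended reals, so that it is \<open>\<infinity>\<close> for the empty set.\<close>

definition osp_tau :: "(nat \<Rightarrow> real \<Rightarrow> 'a \<Rightarrow> nat) \<Rightarrow> real \<Rightarrow> 'a \<Rightarrow> ereal" where
  "osp_tau N t \<omega> =
     Inf (ereal ` {s. 0 < s \<and> osp_label N t \<omega> 1 < osp_label N (t + s) \<omega> 1})"

text \<open>The law of \<open>\<bar>Z\<bar>\<close> for \<open>Z\<close> Gaussian with mean \<open>0\<close> and variance \<open>2\<close>; the second parameter of
  \<^const>\<open>normal_density\<close> is the standard deviation.\<close>

definition abs_gaussian_var2 :: "real measure" where
  "abs_gaussian_var2 =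
     distr (density lborel (\<lambda>x. ennreal (normal_density 0 (sqrt 2) x))) borel (\<lambda>x. \<bar>x\<bar>)"

end

theory Submission
  imports Defs "HOL-Real_Asymp.Real_Asymp"
begin

text \<open>
  Write \<open>L\<^sub>t\<close> for the label at position 1 at time \<open>t\<close>. The proof rests on a dual description of \<open>L\<^sub>t\<close>.
  Let \<open>M\<^sub>t(x)\<close> be the largest label in the positions \<open>1..x\<close>. A ring at the pair \<open>(i, i+1)\<close> puts the
  larger of the two labels at \<open>i\<close>, so it replaces \<open>M(i)\<close> by \<open>M(i+1)\<close> and changes no other prefix
  maximum. Since \<open>M\<^sub>0\<close> is the identity, \<open>L\<^sub>t = M\<^sub>t(1)\<close> is the end point of the path that starts at
  position 1, runs through the rings before time \<open>t\<close> backwards in time, and steps from \<open>i\<close> to \<open>i+1\<close>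
  at each ring of the clock \<open>i\<close> (\<open>fold_oswap_at_1\<close>).

  In particular \<open>L\<close> is nondecreasing in time, and up to a null set \<open>\<tau>(t) > s\<close> means \<open>L\<^sub>t = L\<^bsub>t+s\<^esub>\<close>:
  the backward paths started from time \<open>t\<close> and from time \<open>t+s\<close> end at the same point. Between \<open>t+s\<close>
  and \<open>t\<close> only the second path is alive, and it moves a Poisson distance with mean \<open>s\<close>. From then on
  the two paths read different clocks while they are apart, hence move as independent Poisson walks
  of rate 1, and they stay together once they meet. Their distance is a simple symmetric walk of rate
  2 until it hits 0, and by the reflection principle it hits 0 from distance \<open>g\<close> within time \<open>t\<close> with
  probability \<open>P(W \<ge> g) + P(W > g)\<close>, where \<open>W\<close> is the difference of two independent Poisson variables of
  mean \<open>t\<close>. This gives the exact formula (\<open>prob_label_unchanged\<close>)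
  \<open>P(L\<^sub>t = L\<^bsub>t+s\<^esub>) = P(D \<ge> 0) + P(D > 0)\<close> with \<open>D = N\<^sub>1(t) - N\<^sub>2(t) - (N\<^sub>3(t+s) - N\<^sub>3(t))\<close>.

  For \<open>s = x \<surd>t\<close> the central limit theorem, in the form of Levy's continuity theorem, shows that
  \<open>(D + s) / \<surd>(2t)\<close> converges to a standard normal \<open>Z\<close>. Hence \<open>P(\<tau>(t) > x \<surd>t)\<close> tends to
  \<open>2 P(Z \<ge> x / \<surd>2) = P(\<bar>\<surd>2 Z\<bar> \<ge> x)\<close>, which is the theorem. The same limit gives the finiteness of
  \<open>\<tau>(t)\<close>: if \<open>\<tau>(t) = \<infinity>\<close> then \<open>L\<close> is constant after \<open>t\<close>, which for every \<open>x > 0\<close> has probability at most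
  \<open>2 P(Z \<ge> x / \<surd>2)\<close>.

  The backward paths are studied on a time grid. For each outcome, a grid that is fine enough has at
  most one ring time in each cell, so that the chronological word of rings is read off from
  the set of pairs (clock, cell) in which the clock rings. For a fixed grid these events form an
  independent array, in which the coalescing walks are discrete and the reflection argument
  is an induction on the number of cells (\<open>prob_delayed_walks_meet\<close>). Refining the grid then
  gives the formula in continuous time, and also the measurability of \<open>L\<^sub>t\<close> and \<open>\<tau>(t)\<close>.
\<close>

section \<open>Prefix maxima and the label at position 1\<close>

definition prefix_max :: "(nat \<Rightarrow> nat) \<Rightarrow> nat \<Rightarrow> nat" where
  "prefix_max \<eta> x = Max (\<eta> ` {1..x})"

definition bump :: "nat \<Rightarrow> nat \<Rightarrow> nat" where
  "bump i x = (if x = i then Suc x else x)"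

lemma bump_pos: "1 \<le> x \<Longrightarrow> 1 \<le> bump i x"
  by (simp add: bump_def)

lemma prefix_max_Suc: "1 \<le> x \<Longrightarrow> prefix_max \<eta> (Suc x) = max (prefix_max \<eta> x) (\<eta> (Suc x))"
  unfolding prefix_max_def by (subst atLeastAtMostSuc_conv) (auto simp: max.commute)

lemma prefix_max_1: "prefix_max \<eta> (Suc 0) = \<eta> 1"
  by (simp add: prefix_max_def)

lemma prefix_max_id: "1 \<le> x \<Longrightarrow> prefix_max id x = x"
  unfolding prefix_max_def by (intro Max_eqI) auto

text \<open>Sorting the labels at \<open>i\<close> and \<open>i+1\<close> changes the set of labels in \<open>1..x\<close> only for \<open>x = i\<close>. The new
  label at \<open>i\<close> is the larger one, so the maximum over \<open>1..i\<close> becomes the old maximum over \<open>1..i+1\<close>.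
  The process thus acts on prefix maxima by composition with a deterministic map of positions.\<close>

lemma prefix_max_oswap:
  assumes "1 \<le> i" "1 \<le> x"
  shows "prefix_max (oswap i \<eta>) x = prefix_max \<eta> (bump i x)"
proof -
  have less: "prefix_max (oswap i \<eta>) x = prefix_max \<eta> x" if "x < i" for x
    unfolding prefix_max_def using that by (intro arg_cong[where f=Max] image_cong) (auto simp: oswap_def)
  have at: "prefix_max (oswap i \<eta>) i = prefix_max \<eta> (Suc i)"
  proof (cases "i = 1")
    case True
    then show ?thesis by (simp add: prefix_max_Suc prefix_max_1 oswap_def)
  next
    case False
    then obtain j where j: "i = Suc j" "1 \<le> j" using assms by (cases i) auto
    have "prefix_max (oswap i \<eta>) i = max (prefix_max (oswap i \<eta>) j) (oswap i \<eta> i)"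
      using j by (simp add: prefix_max_Suc)
    also have "\<dots> = max (prefix_max \<eta> j) (max (\<eta> i) (\<eta> (Suc i)))"
      using less[of j] j by (simp add: oswap_def)
    also have "\<dots> = prefix_max \<eta> (Suc i)"
      using j by (simp add: prefix_max_Suc max.assoc)
    finally show ?thesis .
  qed
  have "prefix_max (oswap i \<eta>) (Suc (i + k)) = prefix_max \<eta> (Suc (i + k))" for k
  proof (induction k)
    case 0
    have "prefix_max (oswap i \<eta>) (Suc i) = max (prefix_max \<eta> (Suc i)) (oswap i \<eta> (Suc i))"
      using assms at by (simp add: prefix_max_Suc)
    also have "\<dots> = max (prefix_max \<eta> i) (max (\<eta> (Suc i)) (oswap i \<eta> (Suc i)))"
      using assms by (simp add: prefix_max_Suc max.assoc)
    also have "\<dots> = prefix_max \<eta> (Suc i)"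
    proof -
      have "\<eta> i \<le> prefix_max \<eta> i" using assms by (auto simp: prefix_max_def)
      then show ?thesis using assms by (auto simp: prefix_max_Suc oswap_def)
    qed
    finally show ?case by simp
  next
    case (Suc k)
    then show ?case
      using prefix_max_Suc[of "Suc (i + k)" \<eta>] prefix_max_Suc[of "Suc (i + k)" "oswap i \<eta>"] 
      by (simp add: oswap_def)
  qed
  then have "prefix_max (oswap i \<eta>) x = prefix_max \<eta> x" if "i < x"
    using that by (metis add_Suc less_imp_Suc_add)
  with less[of x] at show ?thesis by (cases x i rule: linorder_cases) (auto simp: bump_def)
qed

lemma prefix_max_fold_oswap:
  assumes "\<forall>i\<in>set w. 1 \<le> i" "1 \<le> x"
  shows "prefix_max (fold oswap w \<eta>) x = prefix_max \<eta> (foldr bump w x) \<and> 1 \<le> foldr bump w x"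
  using assms(1)
proof (induction w arbitrary: \<eta>)
  case Nil
  then show ?case using assms by simp
next
  case (Cons a w)
  then have "prefix_max (fold oswap w (oswap a \<eta>)) x = prefix_max (oswap a \<eta>) (foldr bump w x)"
    and "1 \<le> foldr bump w x" by auto
  with Cons.prems show ?case using bump_pos[of "foldr bump w x" a] by (simp add: prefix_max_oswap)
qed

text \<open>The letters of the word act on the position from the last one to the first one: this is the path
  backwards in time.\<close>

lemma fold_oswap_at_1:
  assumes "\<forall>i\<in>set w. 1 \<le> i"
  shows "fold oswap w id 1 = foldr bump w 1"
  using prefix_max_fold_oswap[OF assms, of 1 id] by (simp add: prefix_max_id prefix_max_1)

section \<open>Ring times of counting paths\<close>

definition clock_path :: "(real \<Rightarrow> nat) \<Rightarrow> bool" where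
  "clock_path f \<longleftrightarrow> mono_on {0..} f \<and> f 0 = 0 \<and> (\<forall>t\<ge>0. (f \<longlongrightarrow> f t) (at_right t))"

definition clock_paths :: "(nat \<Rightarrow> real \<Rightarrow> 'a \<Rightarrow> nat) \<Rightarrow> 'a \<Rightarrow> bool" where
  "clock_paths N \<omega> \<longleftrightarrow> (\<forall>i\<ge>1. clock_path (\<lambda>t. N i t \<omega>))"

lemma clock_pathsD: "clock_paths N \<omega> \<Longrightarrow> 1 \<le> i \<Longrightarrow> clock_path (\<lambda>t. N i t \<omega>)"
  by (simp add: clock_paths_def)

lemma clock_path_mono: "clock_path f \<Longrightarrow> 0 \<le> r \<Longrightarrow> r \<le> s \<Longrightarrow> f r \<le> f s"
  by (auto simp: clock_path_def mono_on_def)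

lemma clock_path_right_const:
  assumes "clock_path f" "0 \<le> t"
  shows "\<forall>\<^sub>F u in at_right t. f u = f t"
proof -
  have "(f \<longlongrightarrow> f t) (at_right t)" using assms by (auto simp: clock_path_def)
  then show ?thesis by (auto simp: tendsto_discrete)
qed

text \<open>A right-continuous path with natural values attains the infimum of the times at which it
  exceeds its value at \<open>a\<close>, and the path jumps there.\<close>

lemma ring_in_interval:
  assumes f: "clock_path f" and ab: "0 \<le> a"  "f a < f b" "a \<le> b"
  shows "\<exists>s. a < s \<and> s \<le> b \<and> 0 < s \<and> (\<forall>r. 0 \<le> r \<and> r < s \<longrightarrow> f r < f s)"
proof -
  define U where "U = {u. a \<le> u \<and> f a < f u}"
  define s where "s = Inf U"
  have bU: "b \<in> U" using ab by (auto simp: U_def)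
  have bdd: "bdd_below U" by (auto simp: U_def intro!: bdd_belowI[of _ a])
  have sb: "s \<le> b" unfolding s_def using bU bdd by (rule cInf_lower)
  have as: "a \<le> s" unfolding s_def using bU by (intro cInf_greatest) (auto simp: U_def)
  have "\<forall>\<^sub>F u in at_right s. f u = f s" using clock_path_right_const[OF f] as ab by auto
  then obtain e where e: "e > s" "\<And>u. s < u \<Longrightarrow> u < e \<Longrightarrow> f u = f s"
    by (auto simp: eventually_at_right_field)
  obtain u where u: "u \<in> U" "u < e" using cInf_lessD[of U e] bU e unfolding s_def by auto
  have "s \<le> u" unfolding s_def using u bdd by (intro cInf_lower) auto
  then have "f u = f s" using e u by (cases "s = u") auto
  with u have fs: "f a < f s" by (auto simp: U_def)
  then have "a \<noteq> s" by auto
  with as have "a < s" by auto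
  moreover have "f r < f s" if "0 \<le> r" "r < s" for r
  proof (cases "a \<le> r")
    case True
    have "r \<notin> U" using that bdd cInf_lower[of r U] by (auto simp: s_def)
    then show ?thesis using True fs by (auto simp: U_def)
  next
    case False
    then show ?thesis using fs clock_path_mono[OF f, of r a] that by auto
  qed
  ultimately show ?thesis using sb ab by (intro exI[of _ s]) auto
qed

lemma jump_iff_rings:
  assumes f: "clock_path (\<lambda>t. N t \<omega>)" and ab: "0 \<le> a" "a \<le> b"
  shows "N a \<omega> < N b \<omega> \<longleftrightarrow> (\<exists>s. a < s \<and> s \<le> b \<and> rings N \<omega> s)"
proof
  assume "N a \<omega> < N b \<omega>"
  from ring_in_interval[OF f ab(1) this ab(2)] show "\<exists>s. a < s \<and> s \<le> b \<and> rings N \<omega> s"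
    by (auto simp: rings_def)
next
  assume "\<exists>s. a < s \<and> s \<le> b \<and> rings N \<omega> s"
  then obtain s where s: "a < s" "s \<le> b" "rings N \<omega> s" by auto
  then have "N a \<omega> < N s \<omega>" using ab by (auto simp: rings_def)
  also have "\<dots> \<le> N b \<omega>" using clock_path_mono[OF f] s ab by auto
  finally show "N a \<omega> < N b \<omega>" .
qed

lemma finite_ring_times:
  assumes f: "clock_path (\<lambda>t. N t \<omega>)"
  shows "finite {s. s \<le> t \<and> rings N \<omega> s}"
proof (rule inj_on_finite)
  show "inj_on (\<lambda>s. N s \<omega>) {s. s \<le> t \<and> rings N \<omega> s}"
  proof (rule inj_onI, clarify)
    fix x y assume *: "rings N \<omega> x" "rings N \<omega> y" "N x \<omega> = N y \<omega>"
    have "x < y \<longrightarrow> N x \<omega> < N y \<omega>" "y < x \<longrightarrow> N y \<omega> < N x \<omega>" "0 < x" "0 < y"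
      using *(1,2) unfolding rings_def by auto
    with *(3) show "x = y" by linarith
  qed
  show "(\<lambda>s. N s \<omega>) ` {s. s \<le> t \<and> rings N \<omega> s} \<subseteq> {..N t \<omega>}"
    using clock_path_mono[OF f] by (auto simp: rings_def)
qed simp

lemma finite_min_gap:
  assumes "finite (S :: real set)"
  shows "\<exists>e>0. \<forall>x\<in>S. \<forall>y\<in>S. x < y \<longrightarrow> e \<le> y - x"
  using assms
proof (induction S)
  case empty
  then show ?case by (auto intro: exI[of _ 1])
next
  case (insert a S)
  then obtain e where e: "e > 0" "\<And>x y. x\<in>S \<Longrightarrow> y\<in>S \<Longrightarrow> x < y \<Longrightarrow> e \<le> y - x" by auto
  define e' where "e' = Min (insert e ((\<lambda>x. \<bar>x - a\<bar>) ` S))"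
  have "e' > 0" using insert e by (auto simp: e'_def)
  moreover have "e' \<le> e" using insert by (auto simp: e'_def)
  moreover have "e' \<le> \<bar>x - a\<bar>" if "x \<in> S" for x using insert that by (auto simp: e'_def)
  ultimately show ?case using e by (intro exI[of _ e']) (fastforce simp: abs_if)
qed

definition ring_times :: "(nat \<Rightarrow> real \<Rightarrow> 'a \<Rightarrow> nat) \<Rightarrow> 'a \<Rightarrow> nat \<Rightarrow> real set" where
  "ring_times N \<omega> n = {s. \<exists>i\<in>{1..<n}. rings (N i) \<omega> s}"

lemma finite_ring_times_upto:
  assumes "clock_paths N \<omega>"
  shows "finite {s \<in> ring_times N \<omega> n. s \<le> t}"
proof -
  have "{s \<in> ring_times N \<omega> n. s \<le> t} = (\<Union>i\<in>{1..<n}. {s. s \<le> t \<and> rings (N i) \<omega> s})"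
    by (auto simp: ring_times_def)
  moreover have "finite {s. s \<le> t \<and> rings (N i) \<omega> s}" if "i \<in> {1..<n}" for i
    using that clock_pathsD[OF assms] by (intro finite_ring_times) auto
  ultimately show ?thesis by simp
qed

lemma ring_word_altdef:
  "ring_word N \<omega> n t =
     concat (map (\<lambda>s. sorted_list_of_set {i\<in>{1..<n}. rings (N i) \<omega> s})
       (sorted_list_of_set {s \<in> ring_times N \<omega> n. s \<le> t}))"
  unfolding ring_word_def ring_times_def by (simp add: conj_commute)

lemma set_ring_word_pos:
  "\<forall>i\<in>set (ring_word N \<omega> n t). 1 \<le> i"
  unfolding ring_word_def by auto

lemma ring_word_0: "ring_word N \<omega> n 0 = []"
proof -
  have "{s \<in> ring_times N \<omega> n. s \<le> 0} = {}" by (auto simp: ring_times_def rings_def)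
  then show ?thesis unfolding ring_word_altdef by (simp only: sorted_list_of_set_empty) simp
qed

lemma sorted_list_of_set_filter_upt:
  "sorted_list_of_set {i\<in>{1..<n::nat}. P i} = filter P [1..<n]"
proof -
  have "{i\<in>{1..<n::nat}. P i} = set (filter P [1..<n])" by auto
  moreover have "sorted_list_of_set (set (filter P [1..<n])) = filter P [1..<n]"
    by (rule sorted_list_of_set.idem_if_sorted_distinct) (auto simp: sorted_wrt_filter)
  ultimately show ?thesis by simp
qed

text \<open>If all rings in \<open>(a, b]\<close> happen at one time, then the word grows by the clocks that ring there, in
  increasing order. These are the clocks whose count grows between \<open>a\<close> and \<open>b\<close>, so the new letters
  depend on the counts at the end points only.\<close>

lemma ring_word_cell:
  assumes cp: "clock_paths N \<omega>" and ab: "0 \<le> a" "a \<le> b"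
    and one: "\<And>x y. x \<in> ring_times N \<omega> n \<Longrightarrow> y \<in> ring_times N \<omega> n \<Longrightarrow> a < x \<Longrightarrow> x < y \<Longrightarrow> y \<le> b \<Longrightarrow> False"
  shows "ring_word N \<omega> n b = ring_word N \<omega> n a @ filter (\<lambda>i. N i a \<omega> < N i b \<omega>) [1..<n]"
proof (cases "\<exists>s\<in>ring_times N \<omega> n. a < s \<and> s \<le> b")
  case False
  then have "{s \<in> ring_times N \<omega> n. s \<le> b} = {s \<in> ring_times N \<omega> n. s \<le> a}" using ab by force
  moreover have "filter (\<lambda>i. N i a \<omega> < N i b \<omega>) [1..<n] = []"
  proof (rule filter_False, rule ballI)
    fix i assume i: "i \<in> set [1..<n]"
    then have "\<not> (\<exists>s. a < s \<and> s \<le> b \<and> rings (N i) \<omega> s)"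
      using False by (auto simp: ring_times_def)
    then show "\<not> N i a \<omega> < N i b \<omega>"
      using jump_iff_rings[of "N i", OF clock_pathsD[OF cp] ab] i by auto
  qed
  ultimately show ?thesis by (simp add: ring_word_altdef)
next
  case True
  then obtain s where s: "s \<in> ring_times N \<omega> n" "a < s" "s \<le> b" by auto
  have uniq: "y = s" if "y \<in> ring_times N \<omega> n" "a < y" "y \<le> b" for y
    using that s one[of y s] one[of s y] by (cases y s rule: linorder_cases) auto
  have "{s \<in> ring_times N \<omega> n. s \<le> b} = insert s {s \<in> ring_times N \<omega> n. s \<le> a}"
  proof (intro equalityI subsetI)
    fix y assume "y \<in> {s \<in> ring_times N \<omega> n. s \<le> b}"
    then show "y \<in> insert s {s \<in> ring_times N \<omega> n. s \<le> a}"
      using uniq[of y] by (cases "y \<le> a") auto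
  qed (use s ab in auto)
  moreover have "sorted_list_of_set (insert s {s \<in> ring_times N \<omega> n. s \<le> a})
      = sorted_list_of_set {s \<in> ring_times N \<omega> n. s \<le> a} @ [s]"
  proof -
    let ?A = "{s \<in> ring_times N \<omega> n. s \<le> a}"
    have fin: "finite ?A" using cp by (rule finite_ring_times_upto)
    have *: "sorted (sorted_list_of_set ?A @ [s])" "distinct (sorted_list_of_set ?A @ [s])"
      using fin s by (auto simp: sorted_append)
    have "set (sorted_list_of_set ?A @ [s]) = insert s ?A" using fin by auto
    then show ?thesis using sorted_list_of_set.idem_if_sorted_distinct[OF *] by simp
  qed
  moreover have "{i\<in>{1..<n}. rings (N i) \<omega> s} = {i\<in>{1..<n}. N i a \<omega> < N i b \<omega>}"
  proof -
    have "rings (N i) \<omega> s \<longleftrightarrow> N i a \<omega> < N i b \<omega>" if i: "i \<in> {1..<n}" for i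
    proof -
      have "N i a \<omega> < N i b \<omega> \<longleftrightarrow> (\<exists>s. a < s \<and> s \<le> b \<and> rings (N i) \<omega> s)"
        using jump_iff_rings[of "N i", OF clock_pathsD[OF cp] ab] i by auto
      also have "\<dots> \<longleftrightarrow> rings (N i) \<omega> s"
      proof
        assume "\<exists>u. a < u \<and> u \<le> b \<and> rings (N i) \<omega> u"
        then obtain u where u: "a < u" "u \<le> b" "rings (N i) \<omega> u" by auto
        then have "u = s" using i by (intro uniq) (auto simp: ring_times_def)
        with u show "rings (N i) \<omega> s" by simp
      qed (use s in auto)
      finally show ?thesis ..
    qed
    then show ?thesis by blast
  qed
  ultimately show ?thesis
    unfolding ring_word_altdef sorted_list_of_set_filter_upt[of n "\<lambda>i. N i a \<omega> < N i b \<omega>", symmetric]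
    by (simp only: map_append concat_append) simp
qed

lemma ring_word_grid:
  assumes cp: "clock_paths N \<omega>"
    and c: "c 0 = 0" "mono c"
    and gap: "\<And>x y. x \<in> ring_times N \<omega> n \<Longrightarrow> y \<in> ring_times N \<omega> n \<Longrightarrow> y \<le> t \<Longrightarrow> x < y \<Longrightarrow> e \<le> y - x"
    and mesh: "\<And>j. c (Suc j) - c j \<le> e"
    and K: "c K \<le> t"
  shows "ring_word N \<omega> n (c K) =
    concat (map (\<lambda>j. filter (\<lambda>i. N i (c j) \<omega> < N i (c (Suc j)) \<omega>) [1..<n]) [0..<K])"
  using K
proof (induction K)
  case 0
  then show ?case by (simp add: c ring_word_0)
next
  case (Suc K)
  have le: "c K \<le> c (Suc K)" "0 \<le> c K" using c monoD[of c 0 K] monoD[of c K "Suc K"] by auto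
  have "ring_word N \<omega> n (c (Suc K)) = ring_word N \<omega> n (c K) @
      filter (\<lambda>i. N i (c K) \<omega> < N i (c (Suc K)) \<omega>) [1..<n]"
  proof (rule ring_word_cell)
    fix x y assume "x \<in> ring_times N \<omega> n" "y \<in> ring_times N \<omega> n" "c K < x" "x < y" "y \<le> c (Suc K)"
    then show False using gap[of x y] mesh[of K] Suc.prems by linarith
  qed (use cp le in auto)
  with Suc le show ?case by simp
qed

section \<open>Backward walks on a time grid\<close>

text \<open>The backward path on a grid: \<open>b (i, j)\<close> says whether the clock \<open>i\<close> rings in the cell \<open>j\<close>, and the
  cells are read from \<open>k - 1\<close> down to \<open>0\<close>. Within a cell the rings are listed in increasing order and
  act from right to left, so a path that has just stepped from \<open>z\<close> to \<open>z + 1\<close> cannot step again in the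
  same cell.\<close>

fun walk :: "(nat \<times> nat \<Rightarrow> bool) \<Rightarrow> nat \<Rightarrow> nat \<Rightarrow> nat" where
  "walk b 0 z = z"
| "walk b (Suc k) z = walk b k (if b (z, k) then Suc z else z)"

lemma walk_mono: "x \<le> y \<Longrightarrow> walk b k x \<le> walk b k y"
proof (induction k arbitrary: x y)
  case (Suc k)
  show ?case using Suc.prems by (cases "x = y") (auto intro!: Suc.IH)
qed simp

text \<open>Walks never cross and never move down. This is the monotonicity of the label in time: the walk from
  the later time has moved up before it meets the grid cells of the earlier one.\<close>

lemma walk_le_walk:
  assumes "m \<le> k" "x \<le> y"
  shows "walk b m x \<le> walk b k y"
  using assms
proof (induction "k - m" arbitrary: k y)
  case 0
  then show ?case by (auto intro: walk_mono)
next
  case (Suc d)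
  then obtain k' where k': "k = Suc k'" "m \<le> k'" "d = k' - m" by (cases k) auto
  then show ?case using Suc.hyps(1)[of k'] Suc.prems by auto
qed

lemma walk_cong:
  assumes "\<And>i j. j < k \<Longrightarrow> z \<le> i \<Longrightarrow> i < z + k \<Longrightarrow> b (i, j) = b' (i, j)"
  shows "walk b k z = walk b' k z"
  using assms
proof (induction k arbitrary: z)
  case (Suc k)
  from Suc.prems[of k z] have "b (z, k) = b' (z, k)" by auto
  then show ?case using Suc by (auto intro!: Suc.IH)
qed simp

lemma foldr_bump_filter_upt:
  "foldr bump (filter P [1..<n]) z = (if 1 \<le> z \<and> z < n \<and> P z then Suc z else z)"
proof (induction n arbitrary: z)
  case (Suc n)
  show ?case
  proof (cases "n = 0")
    case False
    then have "[1..<Suc n] = [1..<n] @ [n]" by simp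
    then have "foldr bump (filter P [1..<Suc n]) z
        = foldr bump (filter P [1..<n]) (if P n then bump n z else z)" by (simp del: upt_Suc)
    also have "\<dots> = (if 1 \<le> z \<and> z < Suc n \<and> P z then Suc z else z)"
      unfolding Suc.IH using False by (auto simp: bump_def)
    finally show ?thesis .
  qed simp
qed simp

text \<open>A clock \<open>n\<close> that stays silent is a barrier for the walk, which therefore does not notice
  that only the clocks below \<open>n\<close> are used on the left.\<close>

lemma foldr_bump_cells:
  assumes "\<And>j. j < K \<Longrightarrow> \<not> b (n, j)" "1 \<le> z" "z \<le> n"
  shows "foldr bump (concat (map (\<lambda>j. filter (\<lambda>i. b (i, j)) [1..<n]) [0..<K])) z = walk b K z"
  using assms
proof (induction K arbitrary: z)
  case (Suc K)
  define z' where "z' = (if b (z, K) then Suc z else z)"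
  have "z' \<le> n" "1 \<le> z'"
    using Suc.prems(1)[of K] Suc.prems(2,3) by (cases "z = n"; auto simp: z'_def)+
  moreover have "foldr bump (filter (\<lambda>i. b (i, K)) [1..<n]) z = z'"
    unfolding foldr_bump_filter_upt z'_def
    using Suc.prems(1)[of K] Suc.prems(2,3) by (cases "z = n") auto
  ultimately show ?case using Suc.IH[of z'] Suc.prems by (simp add: z'_def)
qed simp

definition jumps :: "(nat \<Rightarrow> real \<Rightarrow> 'a \<Rightarrow> nat) \<Rightarrow> (nat \<Rightarrow> real) \<Rightarrow> 'a \<Rightarrow> nat \<times> nat \<Rightarrow> bool" where
  "jumps N c \<omega> = (\<lambda>(i, j). N i (c j) \<omega> < N i (c (Suc j)) \<omega>)"

definition grid :: "real \<Rightarrow> (nat \<Rightarrow> real) \<Rightarrow> bool" where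
  "grid e c \<longleftrightarrow> c 0 = 0 \<and> mono c \<and> (\<forall>j. c (Suc j) - c j \<le> e)"

text \<open>The required mesh is the smallest gap between two of the finitely many ring times, so it depends on
  the outcome.\<close>

lemma finite_osp_grid:
  assumes cp: "clock_paths N \<omega>"
  shows "\<exists>e>0. \<forall>c K. grid e c \<longrightarrow> c K \<le> t \<longrightarrow>
       finite_osp N n (c K) \<omega> 1 =
       foldr bump (concat (map (\<lambda>j. filter (\<lambda>i. jumps N c \<omega> (i, j)) [1..<n]) [0..<K])) 1"
proof -
  have "finite {s \<in> ring_times N \<omega> n. s \<le> t}" using cp by (rule finite_ring_times_upto)
  from finite_min_gap[OF this] obtain e where e: "e > 0"
    "\<And>x y. x \<in> ring_times N \<omega> n \<Longrightarrow> y \<in> ring_times N \<omega> n \<Longrightarrow> y \<le> t \<Longrightarrow> x < y \<Longrightarrow> e \<le> y - x"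
    by fastforce
  show ?thesis
  proof (intro exI[of _ e] conjI allI impI e(1))
    fix c :: "nat \<Rightarrow> real" and K
    assume c: "grid e c" "c K \<le> t"
    have "ring_word N \<omega> n (c K) =
        concat (map (\<lambda>j. filter (\<lambda>i. N i (c j) \<omega> < N i (c (Suc j)) \<omega>) [1..<n]) [0..<K])"
      by (rule ring_word_grid[OF cp _ _ e(2), where t=t]) (use c in \<open>auto simp: grid_def\<close>)
    then show "finite_osp N n (c K) \<omega> 1 =
       foldr bump (concat (map (\<lambda>j. filter (\<lambda>i. jumps N c \<omega> (i, j)) [1..<n]) [0..<K])) 1"
      unfolding finite_osp_def fold_oswap_at_1[OF set_ring_word_pos] by (simp add: jumps_def)
  qed
qed

lemma osp_label_grid:
  assumes cp: "clock_paths N \<omega>"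
    and n: "1 \<le> n" "N n t \<omega> = 0" and t: "0 \<le> (t::real)"
  shows "\<exists>e>0. \<forall>c K. grid e c \<longrightarrow> c K = t \<longrightarrow> osp_label N t \<omega> 1 = walk (jumps N c \<omega>) K 1"
proof -
  \<comment> \<open>The smallest silent clock is the segment that the Harris construction uses.\<close>
  define n' where "n' = (LEAST n. 1 \<le> n \<and> N n t \<omega> = 0)"
  have n': "1 \<le> n'" "N n' t \<omega> = 0"
    using LeastI[of "\<lambda>n. 1 \<le> n \<and> N n t \<omega> = 0" n] n by (auto simp: n'_def)
  from finite_osp_grid[OF cp, of t n'] obtain e where e: "e > 0"
    "\<And>c K. grid e c \<Longrightarrow> c K \<le> t \<Longrightarrow> finite_osp N n' (c K) \<omega> 1 =
       foldr bump (concat (map (\<lambda>j. filter (\<lambda>i. jumps N c \<omega> (i, j)) [1..<n']) [0..<K])) 1"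
    by blast
  show ?thesis
  proof (intro exI[of _ e] conjI allI impI e(1))
    fix c :: "nat \<Rightarrow> real" and K
    assume g: "grid e c" and cK: "c K = t"
    then have c: "c 0 = 0" "mono c" by (auto simp: grid_def)
    have "\<not> jumps N c \<omega> (n', j)" if "j < K" for j
    proof -
      have "c (Suc j) \<le> t" "0 \<le> c (Suc j)"
        using monoD[OF c(2), of "Suc j" K] monoD[OF c(2), of 0 "Suc j"] c cK that by auto
      then have "N n' (c (Suc j)) \<omega> = 0"
        using clock_path_mono[OF clock_pathsD[OF cp n'(1)], of "c (Suc j)" t] n' by auto
      then show ?thesis by (auto simp: jumps_def)
    qed
    from foldr_bump_cells[of K "jumps N c \<omega>" n', OF this, of 1] n' e(2)[OF g, of K] cK
    show "osp_label N t \<omega> 1 = walk (jumps N c \<omega>) K 1"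
      by (simp add: osp_label_def n'_def)
  qed
qed

section \<open>The waiting time and the label at position 1\<close>

lemma finite_osp_right_const:
  assumes cp: "clock_paths N \<omega>" and t: "0 \<le> t"
  shows "\<forall>\<^sub>F u in at_right t. finite_osp N n u \<omega> = finite_osp N n t \<omega>"
proof -
  have "\<forall>\<^sub>F u in at_right t. \<forall>i\<in>{1..<n}. N i u \<omega> = N i t \<omega>"
    by (intro eventually_ball_finite ballI clock_path_right_const[OF clock_pathsD[OF cp]])
       (use t in auto)
  then show ?thesis
    using eventually_at_right_less
  proof eventually_elim
    case (elim u)
    have "x \<notin> ring_times N \<omega> n" if "t < x" "x \<le> u" for x
    proof
      assume "x \<in> ring_times N \<omega> n"
      then obtain i where i: "i \<in> {1..<n}" "rings (N i) \<omega> x" by (auto simp: ring_times_def)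
      have "N i t \<omega> < N i u \<omega>"
        using that i t jump_iff_rings[of "N i" \<omega> t u, OF clock_pathsD[OF cp]] by auto
      with elim i show False by auto
    qed
    then have "\<And>x. x \<in> ring_times N \<omega> n \<Longrightarrow> x \<le> u \<Longrightarrow> x \<le> t" by (meson not_le)
    then have "{s \<in> ring_times N \<omega> n. s \<le> u} = {s \<in> ring_times N \<omega> n. s \<le> t}"
      using elim by (auto simp: not_le dest: leI)
    then show ?case by (simp add: finite_osp_def ring_word_altdef)
  qed
qed

lemma osp_label_right_const:
  assumes cp: "clock_paths N \<omega>" and t: "0 \<le> t"
  shows "\<forall>\<^sub>F u in at_right t. osp_label N u \<omega> 1 = osp_label N t \<omega> 1"
proof -
  define L where "L u = (LEAST n. 1 \<le> n \<and> N n u \<omega> = 0)" for u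
  have "\<forall>\<^sub>F u in at_right t. L u = L t"
  proof (cases "\<exists>n. 1 \<le> n \<and> N n t \<omega> = 0")
    case True
    then have Lt: "1 \<le> L t" "N (L t) t \<omega> = 0"
      using LeastI_ex[of "\<lambda>n. 1 \<le> n \<and> N n t \<omega> = 0"] by (auto simp: L_def)
    have "\<forall>\<^sub>F u in at_right t. \<forall>i\<in>{1..L t}. N i u \<omega> = N i t \<omega>"
      by (intro eventually_ball_finite ballI clock_path_right_const[OF clock_pathsD[OF cp]])
         (use t in auto)
    then show ?thesis
    proof eventually_elim
      case (elim u)
      show ?case unfolding L_def[of u]
      proof (rule Least_equality)
        show "1 \<le> L t \<and> N (L t) u \<omega> = 0" using Lt elim by auto
        fix y assume y: "1 \<le> y \<and> N y u \<omega> = 0"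
        show "L t \<le> y"
        proof (rule ccontr)
          assume "\<not> L t \<le> y"
          then have "y < L t" "N y t \<omega> = 0" using y elim by auto
          then show False using y not_less_Least[of y "\<lambda>n. 1 \<le> n \<and> N n t \<omega> = 0"] by (auto simp: L_def)
        qed
      qed
    qed
  next
    case False
    have "\<forall>\<^sub>F u in at_right t. t < u" by (rule eventually_at_right_less)
    then show ?thesis
    proof eventually_elim
      case (elim u)
      have "(\<lambda>n. 1 \<le> n \<and> N n u \<omega> = 0) = (\<lambda>n. 1 \<le> n \<and> N n t \<omega> = 0)"
      proof (rule ext)
        fix n
        show "(1 \<le> n \<and> N n u \<omega> = 0) = (1 \<le> n \<and> N n t \<omega> = 0)"
          using False clock_path_mono[OF clock_pathsD[OF cp, of n], of t u] elim t by auto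
      qed
      then show ?case by (simp add: L_def)
    qed
  qed
  then show ?thesis
    using finite_osp_right_const[OF cp t, of "L t"]
    by eventually_elim (simp add: osp_label_def L_def)
qed

text \<open>A form of right continuity for functions with discrete values, shifted to the variable \<open>s\<close> in
  \<open>t + s\<close> that enters the waiting time.\<close>

lemma right_const_shift:
  fixes f :: "real \<Rightarrow> nat"
  assumes "\<forall>\<^sub>F u in at_right (t + s). f u = f (t + s)"
  shows "\<exists>e>s. \<forall>u. s \<le> u \<longrightarrow> u < e \<longrightarrow> f (t + u) = f (t + s)"
proof -
  from assms obtain e where e: "e > t + s" "\<And>u. t + s < u \<Longrightarrow> u < e \<Longrightarrow> f u = f (t + s)"
    by (auto simp: eventually_at_right_field)
  show ?thesis
  proof (intro exI[of _ "e - t"] conjI allI impI)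
    fix u assume "s \<le> u" "u < e - t"
    then show "f (t + u) = f (t + s)" using e(2)[of "t + u"] by (cases "u = s") auto
  qed (use e in auto)
qed

text \<open>Right continuity makes the infimum of the jump times attained, hence the inequality on the left is
  not strict.\<close>

lemma Inf_jump_le_iff:
  fixes f :: "real \<Rightarrow> nat"
  assumes mono: "\<And>u v. t \<le> u \<Longrightarrow> u \<le> v \<Longrightarrow> f u \<le> f v"
    and rc: "\<And>u. t \<le> u \<Longrightarrow> \<forall>\<^sub>F v in at_right u. f v = f u" and s: "0 \<le> s"
  shows "Inf (ereal ` {s. 0 < s \<and> f t < f (t + s)}) \<le> ereal s \<longleftrightarrow> f t < f (t + s)"
proof
  assume *: "f t < f (t + s)"
  then have "s \<noteq> 0" by auto
  with * s show "Inf (ereal ` {s. 0 < s \<and> f t < f (t + s)}) \<le> ereal s"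
    by (intro Inf_lower) auto
next
  assume *: "Inf (ereal ` {s. 0 < s \<and> f t < f (t + s)}) \<le> ereal s"
  show "f t < f (t + s)"
  proof (rule ccontr)
    assume "\<not> f t < f (t + s)"
    then have eq: "f (t + s) = f t" using mono[of t "t + s"] s by auto
    have "\<forall>\<^sub>F v in at_right (t + s). f v = f (t + s)" using rc[of "t + s"] s by auto
    from right_const_shift[OF this] obtain e where e: "e > s" "\<And>u. s \<le> u \<Longrightarrow> u < e \<Longrightarrow> f (t + u) = f (t + s)"
      by blast
    have "ereal e \<le> Inf (ereal ` {s. 0 < s \<and> f t < f (t + s)})"
    proof (rule Inf_greatest, clarsimp)
      fix u assume u: "0 < u" "f t < f (t + u)"
      show "e \<le> u"
      proof (rule ccontr)
        assume "\<not> e \<le> u"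
        then have "f (t + u) \<le> f t"
          using e(2)[of u] eq mono[of "t + u" "t + s"] u by (cases "s \<le> u") auto
        with u show False by auto
      qed
    qed
    also note *
    finally show False using e by auto
  qed
qed

text \<open>Reduction to countably many times. It applies to the outcomes of the exceptional null set as well,
  so that the waiting time is measurable as a function on the whole space.\<close>

lemma Inf_jump_less_iff:
  fixes f :: "real \<Rightarrow> nat"
  assumes rc: "\<And>u. t \<le> u \<Longrightarrow> \<forall>\<^sub>F v in at_right u. f v = f u"
  shows "Inf (ereal ` {s. 0 < s \<and> f t < f (t + s)}) < y \<longleftrightarrow>
    (\<exists>r\<in>\<rat>. 0 < r \<and> ereal r < y \<and> f t < f (t + r))"
proof
  assume "Inf (ereal ` {s. 0 < s \<and> f t < f (t + s)}) < y"
  then obtain s where s: "0 < s" "f t < f (t + s)" "ereal s < y"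
    by (auto simp: Inf_less_iff)
  from rc[of "t + s"] s have "\<forall>\<^sub>F v in at_right (t + s). f v = f (t + s)" by auto
  from right_const_shift[OF this] obtain e where e: "e > s" "\<And>u. s \<le> u \<Longrightarrow> u < e \<Longrightarrow> f (t + u) = f (t + s)"
    by blast
  obtain z where z: "ereal s < ereal z" "ereal z < y"
    using ereal_dense2[OF s(3)] by blast
  obtain r where r: "r \<in> \<rat>" "s < r" "r < min e z"
    using Rats_dense_in_real[of s "min e z"] e z by auto
  then have "ereal r < ereal z" by simp
  then have "ereal r < y" using z(2) by (rule less_trans)
  moreover have "f (t + r) = f (t + s)" using e(2)[of r] r by simp
  ultimately show "\<exists>r\<in>\<rat>. 0 < r \<and> ereal r < y \<and> f t < f (t + r)"
    using r(1,2) s(1,2) by (intro bexI[of _ r] conjI) simp_all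
next
  assume "\<exists>r\<in>\<rat>. 0 < r \<and> ereal r < y \<and> f t < f (t + r)"
  then show "Inf (ereal ` {s. 0 < s \<and> f t < f (t + s)}) < y" by (auto simp: Inf_less_iff)
qed

text \<open>A grid with \<open>m\<close> equal cells in \<open>[0, t]\<close> followed by cells of length \<open>s/m\<close>, so that both \<open>t\<close> and \<open>t + s\<close>
  are grid points, with the numbers \<open>m\<close> and \<open>2 m\<close>.\<close>

definition two_scale_grid :: "real \<Rightarrow> real \<Rightarrow> nat \<Rightarrow> nat \<Rightarrow> real" where
  "two_scale_grid t s m j =
     (if j \<le> m then real j * (t / real m) else t + (real j - real m) * (s / real m))"

lemma two_scale_grid_simps:
  "two_scale_grid t s m 0 = 0"
  "0 < m \<Longrightarrow> two_scale_grid t s m m = t"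
  "0 < m \<Longrightarrow> two_scale_grid t s m (2 * m) = t + s"
  by (auto simp: two_scale_grid_def)

lemma two_scale_grid_step:
  assumes "0 < m"
  shows "two_scale_grid t s m (Suc j) - two_scale_grid t s m j = (if j < m then t / m else s / m)"
proof (cases "j < m")
  case True
  then show ?thesis by (simp add: two_scale_grid_def field_simps)
next
  case False
  show ?thesis
  proof (cases "j = m")
    case True
    then show ?thesis using assms by (simp add: two_scale_grid_def)
  next
    case False
    with \<open>\<not> j < m\<close> assms show ?thesis by (simp add: two_scale_grid_def field_simps)
  qed
qed

lemma grid_two_scale:
  assumes "0 < m" "0 \<le> t" "0 \<le> s" "t / m \<le> e" "s / m \<le> e"
  shows "grid e (two_scale_grid t s m)"
proof -
  have "mono (two_scale_grid t s m)"
  proof (rule incseq_SucI)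
    fix j
    have "0 \<le> two_scale_grid t s m (Suc j) - two_scale_grid t s m j"
      unfolding two_scale_grid_step[OF assms(1)] using assms by auto
    then show "two_scale_grid t s m j \<le> two_scale_grid t s m (Suc j)" by simp
  qed
  then show ?thesis using assms
    by (auto simp: grid_def two_scale_grid_step two_scale_grid_simps)
qed

lemma osp_label_eventually_walk:
  assumes cp: "clock_paths N \<omega>" and n: "1 \<le> n" "N n (t + s) \<omega> = 0" and ts: "0 \<le> t" "0 \<le> s"
  shows "\<forall>\<^sub>F m in sequentially. 0 < m \<and>
     osp_label N t \<omega> 1 = walk (jumps N (two_scale_grid t s m) \<omega>) m 1 \<and>
     osp_label N (t + s) \<omega> 1 = walk (jumps N (two_scale_grid t s m) \<omega>) (2 * m) 1"
proof -
  have n0: "N n t \<omega> = 0" using clock_path_mono[OF clock_pathsD[OF cp n(1)], of t "t + s"] n ts by auto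
  obtain e1 where e1: "e1 > 0"
    "\<And>c K. grid e1 c \<Longrightarrow> c K = t \<Longrightarrow> osp_label N t \<omega> 1 = walk (jumps N c \<omega>) K 1"
    using osp_label_grid[OF cp n(1) n0 ts(1)] by blast
  obtain e2 where e2: "e2 > 0"
    "\<And>c K. grid e2 c \<Longrightarrow> c K = t + s \<Longrightarrow> osp_label N (t + s) \<omega> 1 = walk (jumps N c \<omega>) K 1"
    using osp_label_grid[OF cp n] ts by force
  define e where "e = min e1 e2"
  have e: "e > 0" using e1 e2 by (auto simp: e_def)
  have "(\<lambda>m. t / real m) \<longlonglongrightarrow> 0" "(\<lambda>m. s / real m) \<longlonglongrightarrow> 0" by real_asymp+
  then have "\<forall>\<^sub>F m in sequentially. t / real m < e" "\<forall>\<^sub>F m in sequentially. s / real m < e"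
    using e by (auto simp: order_tendsto_iff)
  then show ?thesis using eventually_gt_at_top[of 0]
  proof eventually_elim
    case (elim m)
    have "grid e1 (two_scale_grid t s m)" "grid e2 (two_scale_grid t s m)"
      using elim ts by (auto intro!: grid_two_scale simp: e_def)
    then show ?case
      using e1(2)[of _ m] e2(2)[of _ "2 * m"] elim by (simp add: two_scale_grid_simps)
  qed
qed

lemma osp_label_mono:
  assumes cp: "clock_paths N \<omega>" and n: "1 \<le> n" "N n v \<omega> = 0" and uv: "0 \<le> u" "u \<le> v"
  shows "osp_label N u \<omega> 1 \<le> osp_label N v \<omega> 1"
proof -
  have "N n (u + (v - u)) \<omega> = 0" "0 \<le> v - u" using n uv by auto
  from osp_label_eventually_walk[OF cp n(1) this(1) uv(1) this(2)]
  have "\<forall>\<^sub>F m in sequentially. osp_label N u \<omega> 1 \<le> osp_label N v \<omega> 1"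
  proof eventually_elim
    case (elim m)
    then show ?case
      using walk_le_walk[of m "2 * m" 1 1 "jumps N (two_scale_grid u (v - u) m) \<omega>"] by simp
  qed
  then show ?thesis by simp
qed

lemma osp_tau_le_iff:
  assumes cp: "clock_paths N \<omega>" and ex: "\<And>v. 0 \<le> v \<Longrightarrow> \<exists>n\<ge>1. N n v \<omega> = 0"
    and t: "0 \<le> t" "0 \<le> s"
  shows "osp_tau N t \<omega> \<le> ereal s \<longleftrightarrow> osp_label N t \<omega> 1 < osp_label N (t + s) \<omega> 1"
  unfolding osp_tau_def
proof (rule Inf_jump_le_iff)
  fix u v assume "t \<le> u" "u \<le> v"
  with t ex[of v] show "osp_label N u \<omega> 1 \<le> osp_label N v \<omega> 1"
    using osp_label_mono[OF cp] by force
qed (use osp_label_right_const[OF cp] t in auto)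

lemma osp_tau_nonneg: "0 \<le> osp_tau N t \<omega>"
  unfolding osp_tau_def by (rule Inf_greatest) auto

section \<open>Coalescing walks in an array of Bernoulli cells\<close>

text \<open>Events in the array are described by predicates on all cells that look at finitely many of them
  only; this replaces measurability statements about infinite arrays.\<close>

definition depends_on :: "'i set \<Rightarrow> (('i \<Rightarrow> 'b) \<Rightarrow> 'c) \<Rightarrow> bool" where
  "depends_on T Q \<longleftrightarrow> (\<forall>b b'. (\<forall>i\<in>T. b i = b' i) \<longrightarrow> Q b = Q b')"

lemma depends_onD: "depends_on T Q \<Longrightarrow> (\<And>i. i \<in> T \<Longrightarrow> b i = b' i) \<Longrightarrow> Q b = Q b'"
  by (auto simp: depends_on_def)

text \<open>Rows are clocks and columns are time cells. The success probability may vary with the column,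
  since the two parts of the grid have cells of different length.\<close>

locale bernoulli_array = prob_space M for M :: "'a measure" +
  fixes B :: "'a \<Rightarrow> nat \<times> nat \<Rightarrow> bool" and p :: "nat \<Rightarrow> real"
  assumes indep: "indep_vars (\<lambda>_. count_space UNIV) (\<lambda>a \<omega>. B \<omega> a) ({1..} \<times> UNIV)"
    and prob_B: "1 \<le> i \<Longrightarrow> prob {\<omega>\<in>space M. B \<omega> (i, j)} = p j"
begin

lemma B_measurable: "1 \<le> i \<Longrightarrow> (\<lambda>\<omega>. B \<omega> (i, j)) \<in> M \<rightarrow>\<^sub>M count_space UNIV"
  using indep by (auto simp: indep_vars_def)

lemma sets_depends_on:
  assumes "finite T" "T \<subseteq> {1..} \<times> UNIV" "depends_on T Q"
  shows "{\<omega>\<in>space M. Q (B \<omega>)} \<in> sets M"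
proof -
  have *: "(\<lambda>\<omega>. restrict (B \<omega>) T) \<in> M \<rightarrow>\<^sub>M PiM T (\<lambda>_. count_space UNIV)"
    using B_measurable assms(2) by (intro measurable_restrict) auto
  have "{f \<in> T \<rightarrow>\<^sub>E UNIV. Q f} \<in> sets (PiM T (\<lambda>_. count_space (UNIV :: bool set)))"
    using assms(1) by (subst count_space_PiM_finite) auto
  from measurable_sets[OF * this]
  have "(\<lambda>\<omega>. restrict (B \<omega>) T) -` {f \<in> T \<rightarrow>\<^sub>E UNIV. Q f} \<inter> space M \<in> sets M" .
  also have "(\<lambda>\<omega>. restrict (B \<omega>) T) -` {f \<in> T \<rightarrow>\<^sub>E UNIV. Q f} \<inter> space M = {\<omega>\<in>space M. Q (B \<omega>)}"
    using depends_onD[OF assms(3), of "restrict (B _) T" "B _"] by auto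
  finally show ?thesis .
qed

lemma prob_cell_indep:
  assumes a: "1 \<le> i" and T: "finite T" "T \<subseteq> {1..} \<times> UNIV" "(i, j) \<notin> T" "depends_on T Q"
  shows "prob {\<omega>\<in>space M. B \<omega> (i, j) = u \<and> Q (B \<omega>)} =
    prob {\<omega>\<in>space M. B \<omega> (i, j) = u} * prob {\<omega>\<in>space M. Q (B \<omega>)}"
proof -
  let ?C = "\<lambda>T. PiM T (\<lambda>_. count_space (UNIV :: bool set))"
  let ?X = "\<lambda>\<omega>. restrict (B \<omega>) {(i, j)}" and ?Y = "\<lambda>\<omega>. restrict (B \<omega>) T"
  let ?A = "{f \<in> {(i, j)} \<rightarrow>\<^sub>E UNIV. f (i, j) = u}" and ?Q = "{f \<in> T \<rightarrow>\<^sub>E UNIV. Q f}"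
  have "indep_var (?C {(i, j)}) ?X (?C T) ?Y"
    by (rule indep_var_restrict[OF indep]) (use a T in auto)
  moreover have "?A \<in> sets (?C {(i, j)})" by (subst count_space_PiM_finite) auto
  moreover have "?Q \<in> sets (?C T)" using T by (subst count_space_PiM_finite) auto
  ultimately have "prob ((\<lambda>x. (?X x, ?Y x)) -` (?A \<times> ?Q) \<inter> space M) =
      prob (?X -` ?A \<inter> space M) * prob (?Y -` ?Q \<inter> space M)"
    by (rule indep_varD)
  moreover have "?X -` ?A \<inter> space M = {\<omega>\<in>space M. B \<omega> (i, j) = u}" by auto
  moreover have "Q (?Y \<omega>) = Q (B \<omega>)" for \<omega> using T(4) by (rule depends_onD) auto
  then have "?Y -` ?Q \<inter> space M = {\<omega>\<in>space M. Q (B \<omega>)}"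
    "(\<lambda>x. (?X x, ?Y x)) -` (?A \<times> ?Q) \<inter> space M = {\<omega>\<in>space M. B \<omega> (i, j) = u \<and> Q (B \<omega>)}"
    by auto
  ultimately show ?thesis by simp
qed

lemma prob_not_B: "1 \<le> i \<Longrightarrow> prob {\<omega>\<in>space M. \<not> B \<omega> (i, j)} = 1 - p j"
proof -
  assume i: "1 \<le> i"
  have "{\<omega>\<in>space M. B \<omega> (i, j)} \<in> events"
    using B_measurable[OF i, of j] by measurable
  from prob_neg[OF this] prob_B[OF i] show ?thesis by simp
qed

text \<open>The one-step analysis of a walk: condition on the cell that it reads first.\<close>

lemma prob_split:
  assumes a: "1 \<le> i" and T: "finite T" "T \<subseteq> {1..} \<times> UNIV" "(i, j) \<notin> T"
    "depends_on T (Q True)" "depends_on T (Q False)"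
  shows "prob {\<omega>\<in>space M. Q (B \<omega> (i, j)) (B \<omega>)} =
    p j * prob {\<omega>\<in>space M. Q True (B \<omega>)} + (1 - p j) * prob {\<omega>\<in>space M. Q False (B \<omega>)}"
proof -
  have d: "depends_on (insert (i, j) T) (\<lambda>b. b (i, j) = u \<and> Q u b)" for u
    using T(4,5) unfolding depends_on_def by (cases u) auto
  have eq: "{\<omega>\<in>space M. Q (B \<omega> (i, j)) (B \<omega>)} =
    {\<omega>\<in>space M. B \<omega> (i, j) = True \<and> Q True (B \<omega>)} \<union> {\<omega>\<in>space M. B \<omega> (i, j) = False \<and> Q False (B \<omega>)}"
    (is "_ = ?L \<union> ?R")
  proof (intro equalityI subsetI)
    fix \<omega> assume "\<omega> \<in> {\<omega>\<in>space M. Q (B \<omega> (i, j)) (B \<omega>)}"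
    then show "\<omega> \<in> ?L \<union> ?R" by (cases "B \<omega> (i, j)") auto
  qed auto
  have split: "prob {\<omega>\<in>space M. Q (B \<omega> (i, j)) (B \<omega>)} =
    prob {\<omega>\<in>space M. B \<omega> (i, j) = True \<and> Q True (B \<omega>)} +
    prob {\<omega>\<in>space M. B \<omega> (i, j) = False \<and> Q False (B \<omega>)}"
    unfolding eq
  proof (rule finite_measure_Union)
    have ev: "{\<omega>\<in>space M. B \<omega> (i, j) = u \<and> Q u (B \<omega>)} \<in> events" for u
      by (rule sets_depends_on[OF _ _ d]) (use a T in auto)
    show "?L \<in> events" by (rule ev)
    show "?R \<in> events" by (rule ev)
  qed auto
  show ?thesis
    unfolding split prob_cell_indep[OF a T(1-4)] prob_cell_indep[OF a T(1-3,5)]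
    using a by (simp add: prob_B prob_not_B)
qed

lemma prob_split2:
  assumes a: "1 \<le> i" "1 \<le> i'" "i \<noteq> i'"
    and T: "finite T" "T \<subseteq> {1..} \<times> UNIV" "(i, j) \<notin> T" "(i', j) \<notin> T"
    and d: "\<And>u v. depends_on T (Q u v)"
  shows "prob {\<omega>\<in>space M. Q (B \<omega> (i, j)) (B \<omega> (i', j)) (B \<omega>)} =
    (p j)\<^sup>2 * prob {\<omega>\<in>space M. Q True True (B \<omega>)} + (1 - p j)\<^sup>2 * prob {\<omega>\<in>space M. Q False False (B \<omega>)}
    + p j * (1 - p j) * (prob {\<omega>\<in>space M. Q True False (B \<omega>)} + prob {\<omega>\<in>space M. Q False True (B \<omega>)})"
proof -
  have dep: "depends_on (insert (i', j) T) (\<lambda>b. Q u (b (i', j)) b)" for u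
    unfolding depends_on_def
  proof (intro allI impI)
    fix b b' :: "nat \<times> nat \<Rightarrow> bool" assume *: "\<forall>x\<in>insert (i', j) T. b x = b' x"
    then have "Q u (b (i', j)) b = Q u (b (i', j)) b'" by (intro depends_onD[OF d]) auto
    with * show "Q u (b (i', j)) b = Q u (b' (i', j)) b'" by auto
  qed
  have first: "prob {\<omega>\<in>space M. Q (B \<omega> (i, j)) (B \<omega> (i', j)) (B \<omega>)} =
    p j * prob {\<omega>\<in>space M. Q True (B \<omega> (i', j)) (B \<omega>)} +
    (1 - p j) * prob {\<omega>\<in>space M. Q False (B \<omega> (i', j)) (B \<omega>)}"
    using prob_split[of i "insert (i', j) T" j "\<lambda>u b. Q u (b (i', j)) b"] a T dep by auto
  have second: "prob {\<omega>\<in>space M. Q u (B \<omega> (i', j)) (B \<omega>)} =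
      p j * prob {\<omega>\<in>space M. Q u True (B \<omega>)} + (1 - p j) * prob {\<omega>\<in>space M. Q u False (B \<omega>)}" for u
    using prob_split[of i' T j "\<lambda>v b. Q u v b"] a T d by auto
  show ?thesis unfolding first second by (simp add: algebra_simps power2_eq_square)
qed

end

text \<open>The common value of two probabilities. Let \<open>W\<close> be the walk that in step \<open>k\<close> adds the difference of
  two independent Bernoulli variables with parameter \<open>p k\<close>. The function is \<open>P(W \<ge> d) + P(W > d)\<close>
  after \<open>k\<close> steps, and for \<open>d \<ge> 0\<close> it is also the probability that \<open>W\<close> has hit \<open>d\<close>, by the
  reflection principle: both satisfy the same recursion, with the same values at \<open>k = 0\<close>, and
  \<open>reflected_0\<close> supplies the boundary value 1 at distance 0.\<close>

fun reflected :: "(nat \<Rightarrow> real) \<Rightarrow> nat \<Rightarrow> int \<Rightarrow> real" where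
  "reflected p 0 d = of_bool (d \<le> 0) + of_bool (d < 0)"
| "reflected p (Suc k) d = ((p k)\<^sup>2 + (1 - p k)\<^sup>2) * reflected p k d +
     p k * (1 - p k) * (reflected p k (d - 1) + reflected p k (d + 1))"

lemma reflected_sym: "reflected p k d + reflected p k (- d) = 2"
proof (induction k arbitrary: d)
  case (Suc k)
  have "reflected p (Suc k) d + reflected p (Suc k) (- d) =
    ((p k)\<^sup>2 + (1 - p k)\<^sup>2) * (reflected p k d + reflected p k (- d)) +
    p k * (1 - p k) * ((reflected p k (d - 1) + reflected p k (- (d - 1))) +
      (reflected p k (d + 1) + reflected p k (- (d + 1))))"
  proof -
    have e: "reflected p k (- d - 1) = reflected p k (- (d + 1))"
      "reflected p k (- d + 1) = reflected p k (- (d - 1))"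
      by (rule arg_cong[where f="reflected p k"], simp)+
    show ?thesis unfolding reflected.simps e by (simp only: distrib_left add.assoc add.commute add.left_commute)
  qed
  also have "\<dots> = 2" unfolding Suc by (simp add: algebra_simps power2_eq_square)
  finally show ?case .
qed auto

lemma reflected_0: "reflected p k 0 = 1"
  using reflected_sym[of p k 0] by simp

text \<open>The analogue with \<open>k\<close> additional cells in which only the walk from the later time moves, so that the
  distance can only grow.\<close>

fun delayed :: "(nat \<Rightarrow> real) \<Rightarrow> nat \<Rightarrow> nat \<Rightarrow> int \<Rightarrow> real" where
  "delayed p m 0 d = reflected p m d"
| "delayed p m (Suc k) d = p (m + k) * delayed p m k (d + 1) + (1 - p (m + k)) * delayed p m k d"

definition row_diff :: "nat \<Rightarrow> (nat \<times> nat \<Rightarrow> bool) \<Rightarrow> int" where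
  "row_diff k b = (\<Sum>j<k. of_bool (b (1, j)) - of_bool (b (2, j)))"

definition row_tail :: "nat \<Rightarrow> nat \<Rightarrow> (nat \<times> nat \<Rightarrow> bool) \<Rightarrow> int" where
  "row_tail m k b = (\<Sum>j<k. of_bool (b (3, m + j)))"

lemma row_diff_cong: "(\<And>i j. i \<in> {1, 2} \<Longrightarrow> j < k \<Longrightarrow> b (i, j) = b' (i, j)) \<Longrightarrow> row_diff k b = row_diff k b'"
  unfolding row_diff_def by (rule sum.cong) auto

lemma row_tail_cong: "(\<And>j. j < m + k \<Longrightarrow> b (3, j) = b' (3, j)) \<Longrightarrow> row_tail m k b = row_tail m k b'"
  unfolding row_tail_def by (rule sum.cong) auto

context bernoulli_array
begin

text \<open>Two walks at different positions read different cells of each column, so their distance changes by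
  \<open>1\<close> and \<open>-1\<close> with the same probability \<open>p (1 - p)\<close>. From distance at least 1 it cannot
  jump over 0, hence the boundary value at 0 determines the probability.\<close>

lemma prob_walks_meet:
  assumes "1 \<le> x" "x \<le> y"
  shows "prob {\<omega>\<in>space M. walk (B \<omega>) k x = walk (B \<omega>) k y} = reflected p k (int y - int x)"
  using assms
proof (induction k arbitrary: x y)
  case 0
  then show ?case by (auto simp: prob_space)
next
  case (Suc k)
  show ?case
  proof (cases "x = y")
    case True
    then show ?thesis by (simp add: reflected_0 prob_space del: reflected.simps)
  next
    case False
    with Suc.prems have xy: "1 \<le> x" "x < y" by auto
    define Q where "Q u v b \<longleftrightarrow> walk b k (if u then Suc x else x) = walk b k (if v then Suc y else y)"
      for u v b
    let ?T = "{1..<Suc y + k} \<times> {..<k}"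
    have "depends_on ?T (Q u v)" for u v
      unfolding depends_on_def
    proof (intro allI impI)
      fix b b' :: "nat \<times> nat \<Rightarrow> bool" assume *: "\<forall>i\<in>?T. b i = b' i"
      have "walk b k z = walk b' k z" if "1 \<le> z" "z \<le> Suc y" for z
        using * that by (intro walk_cong) auto
      then show "Q u v b = Q u v b'" using xy by (auto simp: Q_def)
    qed
    from prob_split2[of x y ?T k Q, OF _ _ _ _ _ _ _ this] xy
    have "prob {\<omega>\<in>space M. Q (B \<omega> (x, k)) (B \<omega> (y, k)) (B \<omega>)} =
      (p k)\<^sup>2 * prob {\<omega>\<in>space M. Q True True (B \<omega>)} + (1 - p k)\<^sup>2 * prob {\<omega>\<in>space M. Q False False (B \<omega>)}
      + p k * (1 - p k) * (prob {\<omega>\<in>space M. Q True False (B \<omega>)} + prob {\<omega>\<in>space M. Q False True (B \<omega>)})"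
      by force
    then show ?thesis
      using xy by (simp add: Q_def Suc.IH) (simp add: algebra_simps)
  qed
qed

text \<open>Two fixed rows satisfy the recursion at every distance, without a boundary condition.\<close>

lemma prob_row_diff:
  "prob {\<omega>\<in>space M. d \<le> row_diff k (B \<omega>)} + prob {\<omega>\<in>space M. d < row_diff k (B \<omega>)} = reflected p k d"
proof (induction k arbitrary: d)
  case 0
  then show ?case by (auto simp: row_diff_def prob_space)
next
  case (Suc k)
  define Q where "Q c u v b \<longleftrightarrow> c \<le> row_diff k b + of_bool u - of_bool v" for c :: int and u v b
  let ?T = "{1, 2} \<times> {..<k}"
  have dep: "depends_on ?T (Q c u v)" for c u v
    unfolding depends_on_def
  proof (intro allI impI)
    fix b b' :: "nat \<times> nat \<Rightarrow> bool" assume *: "\<forall>i\<in>?T. b i = b' i"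
    have "row_diff k b = row_diff k b'"
      using * by (intro row_diff_cong) auto
    then show "Q c u v b = Q c u v b'" by (auto simp: Q_def)
  qed
  have *: "prob {\<omega>\<in>space M. c \<le> row_diff (Suc k) (B \<omega>)} =
     ((p k)\<^sup>2 + (1 - p k)\<^sup>2) * prob {\<omega>\<in>space M. c \<le> row_diff k (B \<omega>)} +
     p k * (1 - p k) * (prob {\<omega>\<in>space M. c - 1 \<le> row_diff k (B \<omega>)} +
       prob {\<omega>\<in>space M. c + 1 \<le> row_diff k (B \<omega>)})" for c
  proof -
    have "prob {\<omega>\<in>space M. Q c (B \<omega> (1, k)) (B \<omega> (2, k)) (B \<omega>)} =
      (p k)\<^sup>2 * prob {\<omega>\<in>space M. Q c True True (B \<omega>)} + (1 - p k)\<^sup>2 * prob {\<omega>\<in>space M. Q c False False (B \<omega>)}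
      + p k * (1 - p k) * (prob {\<omega>\<in>space M. Q c True False (B \<omega>)} + prob {\<omega>\<in>space M. Q c False True (B \<omega>)})"
      by (rule prob_split2[where T="?T"]) (use dep in auto)
    moreover have "Q c (b (1, k)) (b (2, k)) b \<longleftrightarrow> c \<le> row_diff (Suc k) b" for b
      by (auto simp: Q_def row_diff_def)
    moreover have "Q c True True b \<longleftrightarrow> c \<le> row_diff k b" "Q c False False b \<longleftrightarrow> c \<le> row_diff k b"
      "Q c True False b \<longleftrightarrow> c - 1 \<le> row_diff k b" "Q c False True b \<longleftrightarrow> c + 1 \<le> row_diff k b" for b
      by (auto simp: Q_def)
    ultimately show ?thesis
      by (simp only:) (simp only: distrib_right)
  qed
  have less: "d < x \<longleftrightarrow> d + 1 \<le> x" for d x :: int by auto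
  show ?case unfolding less *[of d] *[of "d + 1"] reflected.simps
    unfolding Suc[symmetric] less by (simp add: algebra_simps)
qed

lemma prob_walks_meet_delayed:
  assumes "1 \<le> x" "x \<le> y"
  shows "prob {\<omega>\<in>space M. walk (B \<omega>) m x = walk (B \<omega>) (m + k) y} = delayed p m k (int y - int x)"
  using assms
proof (induction k arbitrary: y)
  case 0
  then show ?case by (simp add: prob_walks_meet)
next
  case (Suc k)
  define Q where "Q u b \<longleftrightarrow> walk b m x = walk b (m + k) (if u then Suc y else y)" for u b
  let ?T = "{1..<Suc y + m + k} \<times> {..<m + k}"
  have dep: "depends_on ?T (Q u)" for u
    unfolding depends_on_def
  proof (intro allI impI)
    fix b b' :: "nat \<times> nat \<Rightarrow> bool" assume *: "\<forall>i\<in>?T. b i = b' i"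
    have "walk b l z = walk b' l z" if "1 \<le> z" "z \<le> Suc y" "l \<le> m + k" for z l
      using * that by (intro walk_cong) auto
    then show "Q u b = Q u b'" using Suc.prems by (auto simp: Q_def)
  qed
  have "prob {\<omega>\<in>space M. Q (B \<omega> (y, m + k)) (B \<omega>)} =
      p (m + k) * prob {\<omega>\<in>space M. Q True (B \<omega>)} + (1 - p (m + k)) * prob {\<omega>\<in>space M. Q False (B \<omega>)}"
    by (rule prob_split[where T="?T"]) (use Suc.prems dep in auto)
  then show ?case
    using Suc by (simp add: Q_def algebra_simps)
qed

lemma prob_row_diff_tail:
  "prob {\<omega>\<in>space M. d \<le> row_diff m (B \<omega>) - row_tail m k (B \<omega>)} +
   prob {\<omega>\<in>space M. d < row_diff m (B \<omega>) - row_tail m k (B \<omega>)} = delayed p m k d"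
proof (induction k arbitrary: d)
  case 0
  then show ?case using prob_row_diff by (simp add: row_tail_def)
next
  case (Suc k)
  define Q where "Q c u b \<longleftrightarrow> c \<le> row_diff m b - row_tail m k b - of_bool u" for c :: int and u b
  let ?T = "{1, 2, 3} \<times> {..<m + k}"
  have dep: "depends_on ?T (Q c u)" for c u
    unfolding depends_on_def
  proof (intro allI impI)
    fix b b' :: "nat \<times> nat \<Rightarrow> bool" assume *: "\<forall>i\<in>?T. b i = b' i"
    have "row_diff m b = row_diff m b'" "row_tail m k b = row_tail m k b'"
      using * by (intro row_diff_cong row_tail_cong; auto)+
    then show "Q c u b = Q c u b'" by (auto simp: Q_def)
  qed
  have "prob {\<omega>\<in>space M. Q c (B \<omega> (3, m + k)) (B \<omega>)} =
      p (m + k) * prob {\<omega>\<in>space M. Q c True (B \<omega>)} + (1 - p (m + k)) * prob {\<omega>\<in>space M. Q c False (B \<omega>)}" for c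
    by (rule prob_split[where T="?T"]) (use dep in auto)
  moreover have "Q c (b (3, m + k)) b \<longleftrightarrow> c \<le> row_diff m b - row_tail m (Suc k) b" for c b
    by (auto simp: Q_def row_tail_def)
  moreover have "Q c True b \<longleftrightarrow> c + 1 \<le> row_diff m b - row_tail m k b"
    "Q c False b \<longleftrightarrow> c \<le> row_diff m b - row_tail m k b" for c b
    by (auto simp: Q_def)
  ultimately have *: "prob {\<omega>\<in>space M. c \<le> row_diff m (B \<omega>) - row_tail m (Suc k) (B \<omega>)} =
     p (m + k) * prob {\<omega>\<in>space M. c + 1 \<le> row_diff m (B \<omega>) - row_tail m k (B \<omega>)} +
     (1 - p (m + k)) * prob {\<omega>\<in>space M. c \<le> row_diff m (B \<omega>) - row_tail m k (B \<omega>)}" for c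
    by simp
  have less: "d < x \<longleftrightarrow> d + 1 \<le> x" for d x :: int by auto
  show ?case unfolding less *[of d] *[of "d + 1"] delayed.simps
    unfolding Suc[symmetric] less by (simp add: algebra_simps)
qed

text \<open>The meeting probability of two coalescing walks expressed through three independent rows without
  any coalescence.\<close>

theorem prob_delayed_walks_meet:
  "prob {\<omega>\<in>space M. walk (B \<omega>) m 1 = walk (B \<omega>) (m + k) 1} =
   prob {\<omega>\<in>space M. row_tail m k (B \<omega>) \<le> row_diff m (B \<omega>)} +
   prob {\<omega>\<in>space M. row_tail m k (B \<omega>) < row_diff m (B \<omega>)}"
  using prob_walks_meet_delayed[of 1 1 m k] prob_row_diff_tail[of 0 m k] by simp

end

section \<open>Poisson clocks and their increments\<close>

lemma measurable_diff_nat: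
  fixes f g :: "'a \<Rightarrow> nat"
  assumes [measurable]: "f \<in> M \<rightarrow>\<^sub>M count_space UNIV" "g \<in> M \<rightarrow>\<^sub>M count_space UNIV"
  shows "(\<lambda>x. f x - g x) \<in> M \<rightarrow>\<^sub>M count_space UNIV"
  by measurable

lemma sets_less_nat:
  fixes f g :: "'a \<Rightarrow> nat"
  assumes "f \<in> M \<rightarrow>\<^sub>M count_space UNIV" "g \<in> M \<rightarrow>\<^sub>M count_space UNIV"
  shows "{x\<in>space M. f x < g x} \<in> sets M"
proof -
  have "(\<lambda>x. g x - f x) -` {0<..} \<inter> space M \<in> sets M"
    using measurable_diff_nat[OF assms(2,1)] by (rule measurable_sets) auto
  also have "(\<lambda>x. g x - f x) -` {0<..} \<inter> space M = {x\<in>space M. f x < g x}" by auto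
  finally show ?thesis .
qed

text \<open>Used for labels that are, for each outcome, computed correctly by all fine grids, while no
  single grid is fine enough for all outcomes.\<close>

lemma measurable_eventually_eq:
  fixes g :: "'a \<Rightarrow> nat"
  assumes f: "\<And>m::nat. f m \<in> M \<rightarrow>\<^sub>M count_space UNIV"
    and eq: "\<And>\<omega>. \<omega> \<in> space M \<Longrightarrow> \<forall>\<^sub>F m in sequentially. g \<omega> = f m \<omega>"
  shows "g \<in> M \<rightarrow>\<^sub>M count_space UNIV"
proof -
  have "g -` {k} \<inter> space M \<in> sets M" for k
  proof -
    have "g -` {k} \<inter> space M = {\<omega>\<in>space M. \<forall>\<^sub>F m in sequentially. f m \<omega> = k}"
    proof (intro equalityI subsetI)
      fix \<omega> assume "\<omega> \<in> g -` {k} \<inter> space M"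
      then show "\<omega> \<in> {\<omega>\<in>space M. \<forall>\<^sub>F m in sequentially. f m \<omega> = k}"
        using eq[of \<omega>] by (auto elim: eventually_mono)
    next
      fix \<omega> assume *: "\<omega> \<in> {\<omega>\<in>space M. \<forall>\<^sub>F m in sequentially. f m \<omega> = k}"
      then have "\<forall>\<^sub>F m in sequentially. f m \<omega> = k" "\<forall>\<^sub>F m in sequentially. g \<omega> = f m \<omega>"
        using eq[of \<omega>] by auto
      then have "\<forall>\<^sub>F m in sequentially. g \<omega> = k" by eventually_elim simp
      with * show "\<omega> \<in> g -` {k} \<inter> space M" by simp
    qed
    also have "\<dots> \<in> sets M"
    proof -
      have [measurable]: "Measurable.pred M (\<lambda>\<omega>. f m \<omega> = k)" for m
        using f[of m] by measurable
      show ?thesis unfolding eventually_sequentially by measurable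
    qed
    finally show ?thesis .
  qed
  then show ?thesis by (simp add: measurable_count_space_eq2_countable)
qed

locale poisson_clocks = prob_space M for M :: "'a measure" +
  fixes N :: "nat \<Rightarrow> real \<Rightarrow> 'a \<Rightarrow> nat"
  assumes poisson: "\<And>i. 1 \<le> i \<Longrightarrow> poisson_process M 1 (N i)"
    and indep_clocks: "indep_processes M N {1..}"
begin

lemma N_measurable: "1 \<le> i \<Longrightarrow> 0 \<le> t \<Longrightarrow> N i t \<in> M \<rightarrow>\<^sub>M count_space UNIV"
  using poisson[of i] unfolding poisson_process_def by blast

lemma clock_paths: "\<omega> \<in> space M \<Longrightarrow> clock_paths N \<omega>"
  using poisson unfolding poisson_process_def clock_paths_def clock_path_def by blast

lemma N_mono: "\<omega> \<in> space M \<Longrightarrow> 1 \<le> i \<Longrightarrow> 0 \<le> r \<Longrightarrow> r \<le> s \<Longrightarrow> N i r \<omega> \<le> N i s \<omega>"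
  using clock_path_mono[OF clock_pathsD[OF clock_paths]] by blast

lemma N_0: "\<omega> \<in> space M \<Longrightarrow> 1 \<le> i \<Longrightarrow> N i 0 \<omega> = 0"
  using clock_pathsD[OF clock_paths] unfolding clock_path_def by blast

lemma distr_increment:
  assumes "1 \<le> i" "0 \<le> s" "s < t"
  shows "distr M (count_space UNIV) (\<lambda>\<omega>. N i t \<omega> - N i s \<omega>) = measure_pmf (poisson_pmf (t - s))"
  using poisson[OF assms(1)] assms unfolding poisson_process_def by simp

lemma prob_increment:
  assumes "1 \<le> i" "0 \<le> s" "s < t"
  shows "prob {\<omega>\<in>space M. P (N i t \<omega> - N i s \<omega>)} = measure_pmf.prob (poisson_pmf (t - s)) {k. P k}"
proof -
  have "(\<lambda>\<omega>. N i t \<omega> - N i s \<omega>) \<in> M \<rightarrow>\<^sub>M count_space UNIV"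
    using N_measurable assms by (intro measurable_diff_nat) auto
  then have "measure (distr M (count_space UNIV) (\<lambda>\<omega>. N i t \<omega> - N i s \<omega>)) {k. P k} =
      prob ((\<lambda>\<omega>. N i t \<omega> - N i s \<omega>) -` {k. P k} \<inter> space M)"
    by (intro measure_distr) auto
  also have "(\<lambda>\<omega>. N i t \<omega> - N i s \<omega>) -` {k. P k} \<inter> space M = {\<omega>\<in>space M. P (N i t \<omega> - N i s \<omega>)}"
    by auto
  finally show ?thesis by (simp add: distr_increment[OF assms])
qed

lemma prob_jump:
  assumes "1 \<le> i" "0 \<le> s" "s \<le> t"
  shows "prob {\<omega>\<in>space M. N i s \<omega> < N i t \<omega>} = 1 - exp (- (t - s))"
proof (cases "s = t")
  case False
  have "{\<omega>\<in>space M. N i s \<omega> < N i t \<omega>} = {\<omega>\<in>space M. N i t \<omega> - N i s \<omega> \<in> - {0}}"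
    using N_mono assms by auto
  also have "prob \<dots> = measure_pmf.prob (poisson_pmf (t - s)) (- {0})"
    using False assms by (subst prob_increment) (auto intro: arg_cong2[where f=measure])
  also have "\<dots> = 1 - pmf (poisson_pmf (t - s)) 0"
    by (subst measure_pmf.prob_compl[of "{0}", unfolded measure_pmf_single, simplified, symmetric])
       (simp add: Compl_eq_Diff_UNIV)
  finally show ?thesis using False assms by (simp add: pmf_poisson)
qed simp

definition increment :: "(nat \<Rightarrow> real) \<Rightarrow> nat \<times> nat \<Rightarrow> 'a \<Rightarrow> nat" where
  "increment c = (\<lambda>(i, j) \<omega>. N i (c (Suc j)) \<omega> - N i (c j) \<omega>)"

lemma increment_measurable:
  assumes "1 \<le> fst a" "\<And>j. 0 \<le> c j"
  shows "increment c a \<in> M \<rightarrow>\<^sub>M count_space UNIV"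
  using N_measurable assms unfolding increment_def
  by (cases a) (auto intro!: measurable_diff_nat)

text \<open>Independence of the cells in both directions: the rows are functions of different clocks, and inside a
  row the increments of one Poisson process are independent.\<close>

lemma indep_increments_rectangle:
  assumes c: "0 \<le> c 0" "mono c"
  shows "indep_vars (\<lambda>_. count_space UNIV) (increment c) ({1..Suc n} \<times> {..<Suc K})"
proof -
  let ?I = "{1..Suc n}" and ?J = "{..<Suc K}"
  have pos: "0 \<le> c j" for j using c monoD[of c 0 j] by auto
  let ?P = "PiM {0..} (\<lambda>_. count_space UNIV) :: (real \<Rightarrow> nat) measure"
  define path where "path i \<omega> = (\<lambda>t\<in>{0..}. N i t \<omega>)" for i \<omega>
  have paths: "indep_vars (\<lambda>_. ?P) path {1..}"
    using indep_clocks unfolding indep_processes_def path_def .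
  have within: "indep_vars (\<lambda>_. count_space UNIV) (\<lambda>j. increment c (i, j)) ?J" if "1 \<le> i" for i
    using poisson[OF that] c unfolding poisson_process_def increment_def by simp
  show ?thesis
  proof (subst indep_vars_finite[where E="\<lambda>_. sets (count_space UNIV)"])
    show "\<forall>A\<in>?I \<times> ?J \<rightarrow> sets (count_space UNIV).
       prob (\<Inter>a\<in>?I \<times> ?J. increment c a -` A a \<inter> space M) =
       (\<Prod>a\<in>?I \<times> ?J. prob (increment c a -` A a \<inter> space M))"
    proof
      fix A :: "nat \<times> nat \<Rightarrow> nat set"
      define F where "F i = {f \<in> space ?P. \<forall>j\<in>?J. f (c (Suc j)) - f (c j) \<in> A (i, j)}" for i
      have F: "F i \<in> sets ?P" for i
      proof -
        have "(\<lambda>f. f (c j)) \<in> ?P \<rightarrow>\<^sub>M count_space UNIV" for j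
          using pos by (intro measurable_component_singleton) auto
        then have "(\<lambda>f. f (c (Suc j)) - f (c j)) \<in> ?P \<rightarrow>\<^sub>M count_space UNIV" for j
          by (intro measurable_diff_nat) auto
        from measurable_sets[OF this, of "A (i, _)"]
        have "{f \<in> space ?P. f (c (Suc j)) - f (c j) \<in> A (i, j)} \<in> sets ?P" for j
          by (simp add: vimage_def Int_def conj_commute)
        then show ?thesis unfolding F_def by (intro sets.sets_Collect_finite_All) auto
      qed
      have row: "path i -` F i \<inter> space M = (\<Inter>j\<in>?J. increment c (i, j) -` A (i, j) \<inter> space M)"
        for i
        using pos by (auto simp: F_def path_def increment_def space_PiM)
      have "(\<Inter>a\<in>?I \<times> ?J. increment c a -` A a \<inter> space M) = (\<Inter>i\<in>?I. path i -` F i \<inter> space M)"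
        unfolding row by auto
      also have "prob \<dots> = (\<Prod>i\<in>?I. prob (path i -` F i \<inter> space M))"
        by (rule indep_varsD[OF paths]) (use F in auto)
      also have "\<dots> = (\<Prod>i\<in>?I. \<Prod>j\<in>?J. prob (increment c (i, j) -` A (i, j) \<inter> space M))"
        unfolding row by (intro prod.cong refl indep_varsD_finite[OF within]) auto
      also have "\<dots> = (\<Prod>a\<in>?I \<times> ?J. prob (increment c a -` A a \<inter> space M))"
        unfolding prod.cartesian_product by (rule prod.cong) auto
      finally show "prob (\<Inter>a\<in>?I \<times> ?J. increment c a -` A a \<inter> space M) =
          (\<Prod>a\<in>?I \<times> ?J. prob (increment c a -` A a \<inter> space M))" .
    qed
    show "increment c a \<in> M \<rightarrow>\<^sub>M count_space UNIV" if "a \<in> ?I \<times> ?J" for a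
      using that pos by (intro increment_measurable) auto
  qed (auto simp: Int_stable_def sets.sigma_sets_eq)
qed

lemma indep_increments:
  assumes c: "0 \<le> c 0" "mono c"
  shows "indep_vars (\<lambda>_. count_space UNIV) (increment c) ({1..} \<times> UNIV)"
proof -
  have pos: "0 \<le> c j" for j using c monoD[of c 0 j] by auto
  let ?F = "\<lambda>a. {increment c a -` A \<inter> space M | A. A \<in> sets (count_space UNIV)}"
  have "indep_sets ?F J" if J: "J \<subseteq> {1..} \<times> UNIV" "finite J" for J
  proof -
    obtain n where "\<forall>x\<in>fst ` J \<union> snd ` J. x \<le> n"
      using finite_nat_set_iff_bounded_le[of "fst ` J \<union> snd ` J"] J by blast
    then have n: "fst a \<le> n \<and> snd a \<le> n" if "a \<in> J" for a using that by auto
    have "J \<subseteq> {1..Suc n} \<times> {..<Suc n}" using J n by force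
    moreover have "indep_sets ?F ({1..Suc n} \<times> {..<Suc n})"
      using indep_increments_rectangle[OF c, of n n] unfolding indep_vars_def2 by blast
    ultimately show ?thesis by (rule indep_sets_mono_index)
  qed
  then have "indep_sets ?F ({1..} \<times> UNIV)"
    by (subst indep_sets_finite_index_sets) auto
  then show ?thesis
    unfolding indep_vars_def2 using pos by (auto intro!: increment_measurable)
qed

lemma bernoulli_jumps:
  assumes c: "0 \<le> c 0" "mono c"
  shows "bernoulli_array M (jumps N c) (\<lambda>j. 1 - exp (- (c (Suc j) - c j)))"
proof
  have pos: "0 \<le> c j" for j using c monoD[of c 0 j] by auto
  have "indep_vars (\<lambda>_. count_space UNIV) (\<lambda>a \<omega>. 0 < increment c a \<omega>) ({1..} \<times> UNIV)"
    by (rule indep_vars_compose2[OF indep_increments[OF c]]) auto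
  also have "(\<lambda>a \<omega>. 0 < increment c a \<omega>) = (\<lambda>a \<omega>. jumps N c \<omega> a)"
    by (auto simp: increment_def jumps_def fun_eq_iff)
  finally show "indep_vars (\<lambda>_. count_space UNIV) (\<lambda>a \<omega>. jumps N c \<omega> a) ({1..} \<times> UNIV)" .
  fix i j :: nat assume "1 \<le> i"
  then show "prob {\<omega> \<in> space M. jumps N c \<omega> (i, j)} = 1 - exp (- (c (Suc j) - c j))"
    using prob_jump[of i "c j" "c (Suc j)"] pos monoD[OF c(2), of j "Suc j"]
    by (simp add: jumps_def)
qed

text \<open>Limit along finer and finer grids; on each grid the label depends on finitely many cells.\<close>

lemma finite_osp_measurable:
  assumes t: "0 \<le> t"
  shows "(\<lambda>\<omega>. finite_osp N n t \<omega> 1) \<in> M \<rightarrow>\<^sub>M count_space UNIV"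
proof (rule measurable_eventually_eq)
  define G where "G m b = foldr bump (concat (map (\<lambda>j. filter (\<lambda>i. b (i, j)) [1..<n]) [0..<m])) 1"
    for m and b :: "nat \<times> nat \<Rightarrow> bool"
  define c where "c m = two_scale_grid t 0 (Suc m)" for m
  have c: "c m (Suc m) = t" "grid (t / Suc m) (c m)" for m
    unfolding c_def using t by (auto intro!: grid_two_scale two_scale_grid_simps)
  show "\<forall>\<^sub>F m in sequentially. finite_osp N n t \<omega> 1 = G (Suc m) (jumps N (c m) \<omega>)"
    if \<omega>: "\<omega> \<in> space M" for \<omega>
  proof -
    from finite_osp_grid[OF clock_paths[OF \<omega>], of t n] obtain e where e: "e > 0"
      "\<And>c K. grid e c \<Longrightarrow> c K \<le> t \<Longrightarrow> finite_osp N n (c K) \<omega> 1 = G K (jumps N c \<omega>)"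
      unfolding G_def by blast
    have "(\<lambda>m. t / real (Suc m)) \<longlonglongrightarrow> 0" by real_asymp
    then have "\<forall>\<^sub>F m in sequentially. t / real (Suc m) < e"
      using e by (auto simp: order_tendsto_iff)
    then show ?thesis
    proof eventually_elim
      case (elim m)
      then have "grid e (c m)" using c(2)[of m] by (auto simp: grid_def intro: order_trans less_imp_le)
      from e(2)[OF this, of "Suc m"] show ?case by (simp only: c order_refl)
    qed
  qed
  show "(\<lambda>\<omega>. G (Suc m) (jumps N (c m) \<omega>)) \<in> M \<rightarrow>\<^sub>M count_space UNIV" for m
  proof -
    interpret bernoulli_array M "jumps N (c m)" "\<lambda>j. 1 - exp (- (c m (Suc j) - c m j))"
      using c(2)[of m] by (intro bernoulli_jumps) (auto simp: grid_def)
    have "depends_on ({1..<n} \<times> {..<Suc m}) (\<lambda>b. G (Suc m) b = k)" for k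
      unfolding depends_on_def
    proof (intro allI impI)
      fix b b' :: "nat \<times> nat \<Rightarrow> bool" assume *: "\<forall>i\<in>{1..<n} \<times> {..<Suc m}. b i = b' i"
      have "map (\<lambda>j. filter (\<lambda>i. b (i, j)) [1..<n]) [0..<Suc m] =
          map (\<lambda>j. filter (\<lambda>i. b' (i, j)) [1..<n]) [0..<Suc m]"
        using * by (intro map_cong filter_cong refl) auto
      then show "(G (Suc m) b = k) = (G (Suc m) b' = k)" unfolding G_def by (simp only:)
    qed
    then have "{\<omega>\<in>space M. G (Suc m) (jumps N (c m) \<omega>) = k} \<in> sets M" for k
      by (intro sets_depends_on[of "{1..<n} \<times> {..<Suc m}"]) auto
    moreover have "(\<lambda>\<omega>. G (Suc m) (jumps N (c m) \<omega>)) -` {k} \<inter> space M =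
        {\<omega>\<in>space M. G (Suc m) (jumps N (c m) \<omega>) = k}" for k by auto
    ultimately show ?thesis by (simp add: measurable_count_space_eq2_countable)
  qed
qed

lemma osp_label_measurable:
  assumes t: "0 \<le> t"
  shows "(\<lambda>\<omega>. osp_label N t \<omega> 1) \<in> M \<rightarrow>\<^sub>M count_space UNIV"
  unfolding osp_label_def
proof (rule measurable_compose_countable[where f="\<lambda>n \<omega>. finite_osp N n t \<omega> 1"])
  show "(\<lambda>\<omega>. finite_osp N n t \<omega> 1) \<in> M \<rightarrow>\<^sub>M count_space UNIV" for n
    by (rule finite_osp_measurable[OF t])
  have "Measurable.pred M (\<lambda>\<omega>. 1 \<le> n \<and> N n t \<omega> = 0)" for n
  proof (cases "1 \<le> n")
    case True
    have [measurable]: "N n t \<in> M \<rightarrow>\<^sub>M count_space UNIV" using N_measurable[OF True t] .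
    show ?thesis by measurable
  qed simp
  then show "(\<lambda>\<omega>. LEAST n. 1 \<le> n \<and> N n t \<omega> = 0) \<in> M \<rightarrow>\<^sub>M count_space UNIV"
    by (rule measurable_Least)
qed

lemma sets_label_eq:
  assumes "0 \<le> u" "0 \<le> v"
  shows "{\<omega>\<in>space M. osp_label N u \<omega> 1 = osp_label N v \<omega> 1} \<in> events"
proof -
  have "{\<omega>\<in>space M. osp_label N u \<omega> 1 = osp_label N v \<omega> 1} =
    space M - ({\<omega>\<in>space M. osp_label N u \<omega> 1 < osp_label N v \<omega> 1} \<union>
      {\<omega>\<in>space M. osp_label N v \<omega> 1 < osp_label N u \<omega> 1})" by auto
  also have "\<dots> \<in> events"
    using assms by (intro sets.Diff sets.top sets.Un sets_less_nat osp_label_measurable) auto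
  finally show ?thesis .
qed

lemma osp_tau_measurable:
  assumes t: "0 \<le> t"
  shows "osp_tau N t \<in> borel_measurable M"
proof (rule borel_measurableI_less)
  fix y :: ereal
  have "{\<omega> \<in> space M. osp_tau N t \<omega> < y} =
    (\<Union>r\<in>{r \<in> \<rat>. 0 < r \<and> ereal r < y}. {\<omega> \<in> space M. osp_label N t \<omega> 1 < osp_label N (t + r) \<omega> 1})"
  proof -
    have "osp_tau N t \<omega> < y \<longleftrightarrow>
      (\<exists>r\<in>\<rat>. 0 < r \<and> ereal r < y \<and> osp_label N t \<omega> 1 < osp_label N (t + r) \<omega> 1)"
      if "\<omega> \<in> space M" for \<omega>
      unfolding osp_tau_def using osp_label_right_const[OF clock_paths[OF that]] t
      by (intro Inf_jump_less_iff) auto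
    then show ?thesis by auto
  qed
  also have "\<dots> \<in> sets M"
  proof (rule sets.countable_UN'')
    show "countable {r \<in> \<rat>. 0 < r \<and> ereal r < y}"
      by (rule countable_subset[OF _ countable_rat]) auto
    fix r assume r: "r \<in> {r \<in> \<rat>. 0 < r \<and> ereal r < y}"
    show "{\<omega> \<in> space M. osp_label N t \<omega> 1 < osp_label N (t + r) \<omega> 1} \<in> sets M"
      by (intro sets_less_nat osp_label_measurable) (use r t in auto)
  qed
  finally show "{\<omega> \<in> space M. osp_tau N t \<omega> < y} \<in> sets M" .
qed

text \<open>The first \<open>k\<close> clocks have all rung by time \<open>v\<close> with probability \<open>(1 - exp (-v)) ^ k\<close>.\<close>

lemma AE_silent_pair_at:
  assumes v: "0 \<le> v"
  shows "AE \<omega> in M. \<exists>n\<ge>1. N n v \<omega> = 0"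
proof -
  \<comment> \<open>The first column of this grid is the time interval \<open>(0, v]\<close>.\<close>
  define c where "c j = v * real j" for j
  have c: "0 \<le> c 0" "mono c" using v by (auto simp: c_def mono_def intro!: mult_left_mono)
  interpret bernoulli_array M "jumps N c" "\<lambda>j. 1 - exp (- (c (Suc j) - c j))"
    using c by (rule bernoulli_jumps)
  define E where "E k = (\<Inter>a\<in>{1..Suc k} \<times> {0::nat}. (\<lambda>\<omega>. jumps N c \<omega> a) -` {True} \<inter> space M)" for k
  have jump: "jumps N c \<omega> (i, 0) \<longleftrightarrow> N i v \<omega> \<noteq> 0" if "\<omega> \<in> space M" "1 \<le> i" for \<omega> i
    using N_0[OF that] by (auto simp: jumps_def c_def)
  have probE: "prob (E k) = (1 - exp (- v)) ^ Suc k" for k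
  proof -
    have "prob (E k) = (\<Prod>a\<in>{1..Suc k} \<times> {0::nat}. prob ((\<lambda>\<omega>. jumps N c \<omega> a) -` {True} \<inter> space M))"
      unfolding E_def by (rule indep_varsD[OF indep]) auto
    also have "\<dots> = (\<Prod>a\<in>{1..Suc k} \<times> {0::nat}. 1 - exp (- v))"
    proof (rule prod.cong[OF refl])
      fix a assume "a \<in> {1..Suc k} \<times> {0::nat}"
      then obtain i where a: "a = (i, 0)" "1 \<le> i" by auto
      have "(\<lambda>\<omega>. jumps N c \<omega> a) -` {True} \<inter> space M = {\<omega>\<in>space M. jumps N c \<omega> (i, 0)}"
        unfolding a(1) by blast
      then show "prob ((\<lambda>\<omega>. jumps N c \<omega> a) -` {True} \<inter> space M) = 1 - exp (- v)"
        using prob_B[OF a(2), of 0] by (simp add: c_def)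
    qed
    finally show ?thesis by simp
  qed
  have E_events: "E k \<in> events" for k
  proof -
    have "(\<lambda>\<omega>. jumps N c \<omega> (i, 0)) -` {True} \<inter> space M \<in> events" if "1 \<le> i" for i
      using B_measurable[OF that, of 0] by (rule measurable_sets) simp
    then show ?thesis unfolding E_def by (intro sets.finite_INT) auto
  qed
  have "(\<Inter>k. E k) \<in> events" using E_events by (intro sets.countable_INT) auto
  moreover have "prob (\<Inter>k. E k) \<le> 0"
  proof (rule LIMSEQ_le_const)
    show "(\<lambda>k. (1 - exp (- v)) ^ Suc k) \<longlonglongrightarrow> 0"
      by (rule LIMSEQ_Suc[OF LIMSEQ_realpow_zero]) (use v in auto)
    show "\<exists>k0. \<forall>k\<ge>k0. prob (\<Inter>k. E k) \<le> (1 - exp (- v)) ^ Suc k"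
    proof (intro exI[of _ 0] allI impI)
      fix k
      have "prob (\<Inter>k. E k) \<le> prob (E k)" using E_events by (intro finite_measure_mono) auto
      then show "prob (\<Inter>k. E k) \<le> (1 - exp (- v)) ^ Suc k" by (simp only: probE)
    qed
  qed
  ultimately have "(\<Inter>k. E k) \<in> null_sets M"
    by (simp add: null_sets_def emeasure_eq_measure measure_le_0_iff)
  moreover have "{\<omega>\<in>space M. \<not> (\<exists>n\<ge>1. N n v \<omega> = 0)} \<subseteq> (\<Inter>k. E k)"
  proof (intro subsetI INT_I)
    fix \<omega> k assume \<omega>: "\<omega> \<in> {\<omega>\<in>space M. \<not> (\<exists>n\<ge>1. N n v \<omega> = 0)}"
    show "\<omega> \<in> E k" unfolding E_def using \<omega> jump[of \<omega>] by auto
  qed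
  ultimately show ?thesis by (rule AE_I')
qed

lemma AE_silent_pair:
  "AE \<omega> in M. \<forall>v\<ge>0. \<exists>n\<ge>1. N n v \<omega> = 0"
proof -
  have "AE \<omega> in M. \<forall>k::nat. \<exists>n\<ge>1. N n (real k) \<omega> = 0"
    unfolding AE_all_countable using AE_silent_pair_at by auto
  then show ?thesis
    using AE_space
  proof eventually_elim
    case (elim \<omega>)
    show ?case
    proof (intro allI impI)
      fix v :: real assume v: "0 \<le> v"
      obtain k where k: "v \<le> real k" using real_arch_simple by blast
      obtain n where "n \<ge> 1" "N n (real k) \<omega> = 0" using elim by blast
      with v k N_mono[of \<omega> n v "real k"] elim show "\<exists>n\<ge>1. N n v \<omega> = 0" by auto
    qed
  qed
qed

end

section \<open>The probability that the label does not change\<close>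

lemma (in prob_space) prob_LIMSEQ_eventually_eq:
  assumes A: "\<And>m::nat. A m \<in> events" and B: "B \<in> events"
    and ev: "AE \<omega> in M. \<forall>\<^sub>F m in sequentially. \<omega> \<in> A m \<longleftrightarrow> \<omega> \<in> B"
  shows "(\<lambda>m. prob (A m)) \<longlonglongrightarrow> prob B"
proof -
  have "(\<lambda>m. \<integral>\<omega>. indicator (A m) \<omega> \<partial>M) \<longlonglongrightarrow> (\<integral>\<omega>. indicator B \<omega> \<partial>M :: real)"
  proof (rule integral_dominated_convergence[where w="\<lambda>_. 1"])
    show "AE \<omega> in M. (\<lambda>m. indicator (A m) \<omega>) \<longlonglongrightarrow> (indicator B \<omega> :: real)"
      using ev
    proof eventually_elim
      case (elim \<omega>)
      then have "\<forall>\<^sub>F m in sequentially. (indicator (A m) \<omega> :: real) = indicator B \<omega>"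
        by eventually_elim (simp add: indicator_def)
      then show ?case by (rule tendsto_eventually)
    qed
  qed (use A B in \<open>auto simp: indicator_def\<close>)
  then show ?thesis using A B by simp
qed

lemma (in prob_space) prob_diff_le:
  assumes "A \<in> events" "B \<in> events" "C \<in> events" "A - B \<subseteq> C" "B - A \<subseteq> C"
  shows "\<bar>prob A - prob B\<bar> \<le> prob C"
proof -
  have "prob A \<le> prob (B \<union> C)" "prob B \<le> prob (A \<union> C)"
    using assms by (auto intro!: finite_measure_mono)
  moreover have "prob (B \<union> C) \<le> prob B + prob C" "prob (A \<union> C) \<le> prob A + prob C"
    using assms by (auto intro!: measure_Un_le)
  ultimately show ?thesis by linarith
qed

lemma poisson_ge_2:
  assumes "0 < d"
  shows "measure_pmf.prob (poisson_pmf d) {k. 2 \<le> k} \<le> d\<^sup>2"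
proof -
  have "{k. 2 \<le> k} = UNIV - {0, 1::nat}" by auto
  then have "measure_pmf.prob (poisson_pmf d) {k. 2 \<le> k} = 1 - measure_pmf.prob (poisson_pmf d) {0, 1}"
    using measure_pmf.prob_compl[of "{0, 1}" "poisson_pmf d"] by simp
  also have "measure_pmf.prob (poisson_pmf d) {0, 1} = exp (- d) * (1 + d)"
    using assms by (simp add: measure_measure_pmf_finite pmf_poisson algebra_simps)
  also have "1 - exp (- d) * (1 + d) \<le> 1 - (1 - d) * (1 + d)"
    using exp_ge_add_one_self[of "- d"] assms by (intro diff_left_mono mult_right_mono) auto
  also have "\<dots> = d\<^sup>2" by (simp add: algebra_simps power2_eq_square)
  finally show ?thesis .
qed

context poisson_clocks
begin

lemma prob_double_jump:
  assumes "1 \<le> i" "0 \<le> s" "s < t"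
  shows "prob {\<omega>\<in>space M. 2 \<le> N i t \<omega> - N i s \<omega>} \<le> (t - s)\<^sup>2"
  using prob_increment[OF assms, of "\<lambda>k. 2 \<le> k"] poisson_ge_2[of "t - s"] assms by simp

text \<open>If no cell contains two rings of the clock \<open>i\<close>, counting the cells with a ring is counting the rings.\<close>

lemma sum_jumps_eq:
  assumes \<omega>: "\<omega> \<in> space M" and i: "1 \<le> i" and c: "mono c" "0 \<le> c 0"
    and single: "\<And>j. j < k \<Longrightarrow> \<not> 2 \<le> N i (c (Suc (m + j))) \<omega> - N i (c (m + j)) \<omega>"
  shows "(\<Sum>j<k. of_bool (jumps N c \<omega> (i, m + j)) :: int) = int (N i (c (m + k)) \<omega>) - int (N i (c m) \<omega>)"
  using single
proof (induction k)
  case (Suc k)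
  have "0 \<le> c (m + k)" "c (m + k) \<le> c (Suc (m + k))"
    using c monoD[OF c(1), of 0 "m + k"] monoD[OF c(1), of "m + k" "Suc (m + k)"] by auto
  then have "N i (c (m + k)) \<omega> \<le> N i (c (Suc (m + k))) \<omega>" by (rule N_mono[OF \<omega> i])
  then have "of_bool (jumps N c \<omega> (i, m + k)) = int (N i (c (Suc (m + k))) \<omega>) - int (N i (c (m + k)) \<omega>)"
    using Suc.prems[of k] by (auto simp: jumps_def)
  then show ?case using Suc by simp
qed simp

text \<open>The position of the reflected walk relative to its target: the difference of two clocks up to time
  \<open>t\<close>, minus the distance that the walk from time \<open>t + s\<close> covers before time \<open>t\<close>.\<close>

definition displacement :: "real \<Rightarrow> real \<Rightarrow> 'a \<Rightarrow> int" where
  "displacement t s \<omega> = int (N 1 t \<omega>) - int (N 2 t \<omega>) - (int (N 3 (t + s) \<omega>) - int (N 3 t \<omega>))"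

lemma displacement_sets:
  assumes "0 \<le> t" "0 \<le> s"
  shows "{\<omega>\<in>space M. P (displacement t s \<omega>)} \<in> events"
proof -
  have [measurable]: "N 1 t \<in> M \<rightarrow>\<^sub>M count_space UNIV" "N 2 t \<in> M \<rightarrow>\<^sub>M count_space UNIV"
    "N 3 (t + s) \<in> M \<rightarrow>\<^sub>M count_space UNIV" "N 3 t \<in> M \<rightarrow>\<^sub>M count_space UNIV"
    using assms by (auto intro!: N_measurable)
  show ?thesis unfolding displacement_def by measurable
qed

text \<open>The two sides differ only if one of the clocks 1, 2, 3 rings twice in a relevant cell. A cell of
  length \<open>\<delta>\<close> does so with probability at most \<open>\<delta>\<^sup>2\<close>, and there are \<open>m\<close> cells of length \<open>t/m\<close> for each of
  the clocks 1 and 2, and \<open>m\<close> cells of length \<open>s/m\<close> for the clock 3.\<close>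

lemma row_displacement_approx:
  assumes t: "0 < t" "0 < s" and m: "0 < m"
  defines "c \<equiv> two_scale_grid t s m"
  shows "\<bar>prob {\<omega>\<in>space M. P (row_diff m (jumps N c \<omega>) - row_tail m m (jumps N c \<omega>))} -
    prob {\<omega>\<in>space M. P (displacement t s \<omega>)}\<bar> \<le> (2 * t\<^sup>2 + s\<^sup>2) / m"
proof -
  have g: "grid (max (t / m) (s / m)) c" unfolding c_def using t m by (intro grid_two_scale) auto
  then have c: "0 \<le> c 0" "mono c" by (auto simp: grid_def)
  interpret bernoulli_array M "jumps N c" "\<lambda>j. 1 - exp (- (c (Suc j) - c j))"
    using c by (rule bernoulli_jumps)
  have c_ends: "c 0 = 0" "c m = t" "c (m + m) = t + s"
    using m two_scale_grid_simps(3)[of m t s] by (auto simp: c_def two_scale_grid_simps mult_2)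
  have step: "c (Suc j) - c j = (if j < m then t / m else s / m)" for j
    unfolding c_def by (rule two_scale_grid_step[OF m])
  have "0 < c (Suc j) - c j" for j unfolding step using t m by simp
  then have c_less: "c j < c (Suc j)" for j by simp
  have c_pos: "0 \<le> c j" for j using monoD[OF c(2), of 0 j] c by auto
  define Bad where "Bad i j = {\<omega>\<in>space M. 2 \<le> N i (c (Suc j)) \<omega> - N i (c j) \<omega>}" for i j
  have Bad: "Bad i j \<in> events" "prob (Bad i j) \<le> (c (Suc j) - c j)\<^sup>2" if "1 \<le> i" for i j
  proof -
    have "N i (c (Suc j)) \<in> M \<rightarrow>\<^sub>M count_space UNIV" "N i (c j) \<in> M \<rightarrow>\<^sub>M count_space UNIV"
      using that c_pos by (auto intro!: N_measurable)
    from sets_less_nat[OF _ measurable_diff_nat[OF this], of "\<lambda>_. 1"]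
    show "Bad i j \<in> events" unfolding Bad_def by (simp add: Suc_le_eq numeral_2_eq_2)
    show "prob (Bad i j) \<le> (c (Suc j) - c j)\<^sup>2"
      unfolding Bad_def using that c_pos c_less by (intro prob_double_jump)
  qed
  let ?I = "{1::nat, 2} \<times> {..<m} \<union> {3} \<times> {m..<m + m}"
  let ?C = "\<Union>x\<in>?I. Bad (fst x) (snd x)"
  have C: "?C \<in> events" using Bad(1) by (intro sets.finite_UN) auto
  have good: "row_diff m (jumps N c \<omega>) - row_tail m m (jumps N c \<omega>) = displacement t s \<omega>"
    if \<omega>: "\<omega> \<in> space M" "\<omega> \<notin> ?C" for \<omega>
  proof -
    have single: "\<not> 2 \<le> N i (c (Suc j)) \<omega> - N i (c j) \<omega>" if "(i, j) \<in> ?I" for i j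
    proof
      assume "2 \<le> N i (c (Suc j)) \<omega> - N i (c j) \<omega>"
      then have "\<omega> \<in> Bad (fst (i, j)) (snd (i, j))" using \<omega>(1) by (simp add: Bad_def)
      with that \<omega>(2) show False by blast
    qed
    then have "(\<Sum>j<m. of_bool (jumps N c \<omega> (i, 0 + j)) :: int) = int (N i (c (0 + m)) \<omega>) - int (N i (c 0) \<omega>)"
      if "i \<in> {1, 2}" for i
      using that by (intro sum_jumps_eq[OF \<omega>(1) _ c(2,1)]) auto
    then have "row_diff m (jumps N c \<omega>) = int (N 1 t \<omega>) - int (N 2 t \<omega>)"
      using N_0[OF \<omega>(1)] by (simp add: row_diff_def sum_subtractf c_ends)
    moreover have "row_tail m m (jumps N c \<omega>) = int (N 3 (c (m + m)) \<omega>) - int (N 3 (c m) \<omega>)"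
      unfolding row_tail_def
      by (rule sum_jumps_eq[OF \<omega>(1) _ c(2,1)]) (use single in auto)
    ultimately show ?thesis by (simp add: displacement_def c_ends)
  qed
  have "\<bar>prob {\<omega>\<in>space M. P (row_diff m (jumps N c \<omega>) - row_tail m m (jumps N c \<omega>))} -
    prob {\<omega>\<in>space M. P (displacement t s \<omega>)}\<bar> \<le> prob ?C"
  proof (rule prob_diff_le)
    have "depends_on ({1, 2, 3} \<times> {..<m + m}) (\<lambda>b. P (row_diff m b - row_tail m m b))"
      unfolding depends_on_def
    proof (intro allI impI)
      fix b b' :: "nat \<times> nat \<Rightarrow> bool" assume *: "\<forall>i\<in>{1, 2, 3} \<times> {..<m + m}. b i = b' i"
      have "row_diff m b = row_diff m b'" "row_tail m m b = row_tail m m b'"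
        using * by (intro row_diff_cong row_tail_cong; auto)+
      then show "P (row_diff m b - row_tail m m b) = P (row_diff m b' - row_tail m m b')" by simp
    qed
    then show "{\<omega>\<in>space M. P (row_diff m (jumps N c \<omega>) - row_tail m m (jumps N c \<omega>))} \<in> events"
      by (intro sets_depends_on[of "{1, 2, 3} \<times> {..<m + m}"]) auto
    show "{\<omega>\<in>space M. P (displacement t s \<omega>)} \<in> events" using t by (intro displacement_sets) auto
  qed (use C in \<open>auto simp: good simp del: UN_iff\<close>)
  also have "prob ?C \<le> (\<Sum>x\<in>?I. prob (Bad (fst x) (snd x)))"
    by (rule finite_measure_subadditive_finite) (use Bad(1) in auto)
  also have "\<dots> \<le> (\<Sum>x\<in>?I. (c (Suc (snd x)) - c (snd x))\<^sup>2)"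
    by (intro sum_mono) (use Bad(2) in auto)
  also have "\<dots> = (\<Sum>x\<in>{1::nat, 2} \<times> {..<m}. (c (Suc (snd x)) - c (snd x))\<^sup>2) +
      (\<Sum>x\<in>{3::nat} \<times> {m..<m + m}. (c (Suc (snd x)) - c (snd x))\<^sup>2)"
    by (rule sum.union_disjoint) auto
  also have "\<dots> = (\<Sum>x\<in>{1::nat, 2} \<times> {..<m}. (t / m)\<^sup>2) + (\<Sum>x\<in>{3::nat} \<times> {m..<m + m}. (s / m)\<^sup>2)"
    by (intro arg_cong2[where f="(+)"] sum.cong refl) (auto simp: step)
  also have "\<dots> = 2 * m * (t / m)\<^sup>2 + m * (s / m)\<^sup>2"
    by (simp add: card_cartesian_product)
  also have "\<dots> = (2 * t\<^sup>2 + s\<^sup>2) / m"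
    using m by (simp add: field_simps power2_eq_square)
  finally show ?thesis .
qed

text \<open>Both sides are limits of the discrete identity \<open>prob_delayed_walks_meet\<close>: the left side because
  almost every outcome is eventually resolved by the grid, the right side by
  \<open>row_displacement_approx\<close>.\<close>

theorem prob_label_unchanged:
  assumes t: "0 < t" "0 < s"
  shows "prob {\<omega>\<in>space M. osp_label N t \<omega> 1 = osp_label N (t + s) \<omega> 1} =
    prob {\<omega>\<in>space M. 0 \<le> displacement t s \<omega>} + prob {\<omega>\<in>space M. 0 < displacement t s \<omega>}"
proof (rule LIMSEQ_unique)
  define c where "c m = two_scale_grid t s (Suc m)" for m
  define A where "A m = {\<omega>\<in>space M. walk (jumps N (c m) \<omega>) (Suc m) 1 = walk (jumps N (c m) \<omega>) (Suc m + Suc m) 1}" for m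
  have "grid (max (t / Suc m) (s / Suc m)) (c m)" for m
    unfolding c_def using t by (intro grid_two_scale) auto
  then have "0 \<le> c m 0" "mono (c m)" for m by (auto simp: grid_def)
  then have array: "bernoulli_array M (jumps N (c m)) (\<lambda>j. 1 - exp (- (c m (Suc j) - c m j)))" for m
    by (rule bernoulli_jumps)
  show "(\<lambda>m. prob (A m)) \<longlonglongrightarrow> prob {\<omega>\<in>space M. osp_label N t \<omega> 1 = osp_label N (t + s) \<omega> 1}"
  proof (rule prob_LIMSEQ_eventually_eq)
    show "A m \<in> events" for m
    proof -
      interpret bernoulli_array M "jumps N (c m)" "\<lambda>j. 1 - exp (- (c m (Suc j) - c m j))"
        by (rule array)
      let ?T = "{1..<1 + (Suc m + Suc m)} \<times> {..<Suc m + Suc m}"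
      have "depends_on ?T (\<lambda>b. walk b (Suc m) 1 = walk b (Suc m + Suc m) 1)"
        unfolding depends_on_def
      proof (intro allI impI)
        fix b b' :: "nat \<times> nat \<Rightarrow> bool" assume *: "\<forall>i\<in>?T. b i = b' i"
        have "walk b l 1 = walk b' l 1" if "l \<le> Suc m + Suc m" for l
          using * that by (intro walk_cong) auto
        then show "(walk b (Suc m) 1 = walk b (Suc m + Suc m) 1) \<longleftrightarrow>
            (walk b' (Suc m) 1 = walk b' (Suc m + Suc m) 1)"
          by (simp del: walk.simps)
      qed
      then show ?thesis unfolding A_def by (intro sets_depends_on[of ?T]) (simp_all del: walk.simps, force)
    qed
    show "{\<omega>\<in>space M. osp_label N t \<omega> 1 = osp_label N (t + s) \<omega> 1} \<in> events"
      using t by (intro sets_label_eq) auto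
    show "AE \<omega> in M. \<forall>\<^sub>F m in sequentially. \<omega> \<in> A m \<longleftrightarrow>
        \<omega> \<in> {\<omega>\<in>space M. osp_label N t \<omega> 1 = osp_label N (t + s) \<omega> 1}"
      using AE_silent_pair AE_space
    proof eventually_elim
      case (elim \<omega>)
      then obtain n where n: "1 \<le> n" "N n (t + s) \<omega> = 0" using t by (meson add_nonneg_nonneg less_imp_le)
      have ts: "0 \<le> t" "0 \<le> s" using t by auto
      have "\<forall>\<^sub>F m in sequentially. 0 < Suc m \<and>
          osp_label N t \<omega> 1 = walk (jumps N (c m) \<omega>) (Suc m) 1 \<and>
          osp_label N (t + s) \<omega> 1 = walk (jumps N (c m) \<omega>) (2 * Suc m) 1"
        unfolding c_def
        by (rule eventually_sequentially_Suc[THEN iffD2]) (rule osp_label_eventually_walk[OF clock_paths[OF elim(2)] n ts])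
      then show ?case
      proof eventually_elim
        case (elim m)
        with \<open>\<omega> \<in> space M\<close> show ?case
          unfolding A_def mult_2 by (simp del: walk.simps)
      qed
    qed
  qed
  have lim: "(\<lambda>m. prob {\<omega>\<in>space M. P (row_diff (Suc m) (jumps N (c m) \<omega>) -
        row_tail (Suc m) (Suc m) (jumps N (c m) \<omega>))}) \<longlonglongrightarrow> prob {\<omega>\<in>space M. P (displacement t s \<omega>)}" for P
  proof (rule LIM_zero_cancel, rule Lim_null_comparison)
    show "\<forall>\<^sub>F m in sequentially. norm (prob {\<omega>\<in>space M. P (row_diff (Suc m) (jumps N (c m) \<omega>) -
        row_tail (Suc m) (Suc m) (jumps N (c m) \<omega>))} - prob {\<omega>\<in>space M. P (displacement t s \<omega>)})
        \<le> (2 * t\<^sup>2 + s\<^sup>2) / real (Suc m)"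
      unfolding c_def real_norm_def by (intro always_eventually allI row_displacement_approx t) auto
    show "(\<lambda>m. (2 * t\<^sup>2 + s\<^sup>2) / real (Suc m)) \<longlonglongrightarrow> 0" by real_asymp
  qed
  have "prob (A m) =
    prob {\<omega>\<in>space M. 0 \<le> row_diff (Suc m) (jumps N (c m) \<omega>) - row_tail (Suc m) (Suc m) (jumps N (c m) \<omega>)} +
    prob {\<omega>\<in>space M. 0 < row_diff (Suc m) (jumps N (c m) \<omega>) - row_tail (Suc m) (Suc m) (jumps N (c m) \<omega>)}" for m
    using bernoulli_array.prob_delayed_walks_meet[OF array, of m "Suc m" "Suc m"]
    unfolding A_def by (simp del: walk.simps)
  then show "(\<lambda>m. prob (A m)) \<longlonglongrightarrow>
      prob {\<omega>\<in>space M. 0 \<le> displacement t s \<omega>} + prob {\<omega>\<in>space M. 0 < displacement t s \<omega>}"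
    using tendsto_add[OF lim[of "\<lambda>d. 0 \<le> d"] lim[of "\<lambda>d. 0 < d"]] by simp
qed

end

section \<open>Characteristic functions and the limit law\<close>

lemma poisson_characteristic_function:
  assumes l: "0 < l"
  shows "(\<integral>k. iexp (u * real k) \<partial>measure_pmf (poisson_pmf l)) = exp (complex_of_real l * (iexp u - 1))"
proof -
  define f where "f k = complex_of_real (pmf (poisson_pmf l) k) * iexp (u * real k)" for k :: nat
  have f_eq: "f k = complex_of_real (exp (- l)) * ((complex_of_real l * iexp u) ^ k /\<^sub>R fact k)" for k
  proof -
    have "iexp (u * real k) = iexp u ^ k"
      by (simp add: exp_of_nat_mult[symmetric] algebra_simps)
    then show ?thesis using l
      by (simp add: f_def pmf_poisson power_mult_distrib scaleR_conv_of_real divide_inverse)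
  qed
  have norm_f: "norm (f k) = exp (- l) * (l ^ k /\<^sub>R fact k)" for k
    unfolding f_def norm_mult norm_of_real using l by (simp add: pmf_poisson divide_inverse)
  have "summable (\<lambda>k. norm (f k))"
    unfolding norm_f by (intro summable_mult sums_summable[OF exp_converges])
  then have int: "integrable (count_space UNIV) f"
    by (simp add: integrable_count_space_nat_iff)
  have "(\<integral>k. iexp (u * real k) \<partial>measure_pmf (poisson_pmf l)) = (\<integral>k. f k \<partial>count_space UNIV)"
    unfolding measure_pmf_eq_density f_def
    by (subst integral_density) (auto simp: scaleR_conv_of_real)
  also have "f sums \<dots>" using sums_integral_count_space_nat[OF int] .
  moreover have "f sums (complex_of_real (exp (- l)) * exp (complex_of_real l * iexp u))"
    unfolding f_eq by (intro sums_mult exp_converges)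
  ultimately have "(\<integral>k. iexp (u * real k) \<partial>measure_pmf (poisson_pmf l)) =
      complex_of_real (exp (- l)) * exp (complex_of_real l * iexp u)"
    using sums_unique2 by metis
  also have "\<dots> = exp (complex_of_real l * (iexp u - 1))"
    by (simp add: exp_of_real[symmetric] exp_add[symmetric] algebra_simps)
  finally show ?thesis .
qed

text \<open>Real and imaginary part of the logarithm of the characteristic function at \<open>\<theta>\<close> of the scaled
  displacement, see \<open>char_scaled_displacement\<close> below. The first limit comes from
  \<open>2 T (cos u - 1) \<approx> - T u\<^sup>2 = - \<theta>\<^sup>2 / 2\<close> for \<open>u = \<theta> / sqrt (2 T)\<close>.\<close>

lemma limit_exponent_re:
  "((\<lambda>T. (2 * T + x * sqrt T) * (cos (\<theta> / sqrt (2 * T)) - 1)) \<longlongrightarrow> - \<theta>\<^sup>2 / 2) at_top"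
proof (cases "\<theta> = 0")
  case False
  have "(2 :: real) powr (1 / 2) = sqrt 2" by (simp add: powr_half_sqrt)
  then have "- (\<theta> * inverse (2 powr (1 / 2)) * (\<theta> * inverse (2 powr (1 / 2)))) = - \<theta>\<^sup>2 / 2"
    by (simp add: field_simps power2_eq_square)
  with False show ?thesis by real_asymp
qed simp

lemma limit_exponent_im:
  "((\<lambda>T. x * sqrt T * (\<theta> / sqrt (2 * T) - sin (\<theta> / sqrt (2 * T)))) \<longlongrightarrow> 0) at_top"
  by real_asymp

lemma std_normal_uminus:
  "distr std_normal_distribution borel uminus = std_normal_distribution"
proof -
  interpret real_distribution std_normal_distribution by (rule real_dist_normal_dist)
  have "char (distr std_normal_distribution borel uminus) t = char std_normal_distribution (- t)" for t
    unfolding char_def by (subst integral_distr) auto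
  then have "char (distr std_normal_distribution borel uminus) = char std_normal_distribution"
    by (simp add: char_std_normal_distribution fun_eq_iff)
  then show ?thesis
    by (intro Levy_uniqueness real_dist_normal_dist real_distribution_distr) auto
qed

lemma std_normal_atomless: "measure std_normal_distribution {y} = 0"
proof -
  have "emeasure std_normal_distribution {y} = 0"
    by (subst emeasure_density) (auto simp: nn_integral_indicator_singleton)
  then show ?thesis by (simp add: measure_def)
qed

lemma std_normal_tail_open:
  "measure std_normal_distribution {y<..} = measure std_normal_distribution {y..}"
proof -
  interpret real_distribution std_normal_distribution by (rule real_dist_normal_dist)
  have "{y..} = {y} \<union> {y<..}" by auto
  moreover have "prob ({y} \<union> {y<..}) = prob {y} + prob {y<..}"
    by (rule finite_measure_Union) auto
  ultimately show ?thesis by (simp add: std_normal_atomless)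
qed

lemma std_normal_interval:
  assumes "0 \<le> y"
  shows "measure std_normal_distribution {- y..y} = 1 - 2 * measure std_normal_distribution {y..}"
proof -
  interpret real_distribution std_normal_distribution by (rule real_dist_normal_dist)
  have "prob {..<- y} = measure (distr std_normal_distribution borel uminus) {..<- y}"
    by (simp only: std_normal_uminus)
  also have "\<dots> = prob {y<..}"
    by (subst measure_distr) (auto intro!: arg_cong[where f=prob])
  finally have lower: "prob {..<- y} = prob {y..}" by (simp add: std_normal_tail_open)
  have "UNIV = {..<- y} \<union> {- y..y} \<union> {y<..}" using assms by auto
  then have "1 = prob ({..<- y} \<union> {- y..y} \<union> {y<..})" using prob_space by simp
  also have "\<dots> = prob {..<- y} + prob {- y..y} + prob {y<..}"
    using assms by (subst finite_measure_Union; (subst finite_measure_Union)?) auto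
  finally show ?thesis by (simp add: lower std_normal_tail_open)
qed

text \<open>A Gaussian variable of variance 2 is \<open>sqrt 2\<close> times a standard one, and the two tails of the latter
  have the same weight.\<close>

lemma cdf_abs_gaussian_var2:
  "cdf abs_gaussian_var2 x =
    (if x < 0 then 0 else 1 - 2 * measure std_normal_distribution {x / sqrt 2..})"
proof -
  let ?N = "density lborel (\<lambda>x. ennreal (normal_density 0 (sqrt 2) x))"
  interpret prob_space ?N by (rule prob_space_normal_density) simp
  have "distributed ?N lborel (\<lambda>x. x) (normal_density 0 (sqrt 2))"
    by (simp add: distributed_def distr_id2)
  then have "distributed ?N lborel (\<lambda>x. (x - 0) / sqrt 2) std_normal_density"
    by (subst (asm) normal_standard_normal_convert) auto
  then have std: "distr ?N borel (\<lambda>x. x / sqrt 2) = std_normal_distribution"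
    by (simp add: distributed_def cong: distr_cong)
  have "cdf abs_gaussian_var2 x = measure ?N {y. \<bar>y\<bar> \<le> x}"
    unfolding cdf_def abs_gaussian_var2_def
    by (subst measure_distr) (auto intro!: arg_cong[where f="measure ?N"])
  also have "\<dots> = measure (distr ?N borel (\<lambda>x. x / sqrt 2)) {- (x / sqrt 2)..x / sqrt 2}"
    by (subst measure_distr) (auto intro!: arg_cong[where f="measure ?N"] simp: field_simps)
  also have "\<dots> = measure std_normal_distribution {- (x / sqrt 2)..x / sqrt 2}" unfolding std ..
  finally show ?thesis
    using std_normal_interval[of "x / sqrt 2"] by (auto simp: divide_neg_pos)
qed

section \<open>The limit theorem\<close>

context poisson_clocks
begin

text \<open>Adding the mean \<open>x * sqrt t\<close> of the third Poisson variable centres the displacement, and \<open>2 * t\<close> is the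
  variance of the other two; the variance \<open>x * sqrt t\<close> of the third one is of lower order. The events
  \<open>displacement \<ge> 0\<close> and \<open>> 0\<close> become comparisons with the constant \<open>x / sqrt 2\<close>.\<close>

definition scaled_displacement :: "real \<Rightarrow> real \<Rightarrow> 'a \<Rightarrow> real" where
  "scaled_displacement x t \<omega> =
     (real_of_int (displacement t (x * sqrt t) \<omega>) + x * sqrt t) / sqrt (2 * t)"

lemma char_scaled_increment:
  assumes i: "1 \<le> i" and st: "0 \<le> s" "s < t"
  shows "char (distr M borel (\<lambda>\<omega>. a * real (N i t \<omega> - N i s \<omega>) + b)) \<theta> =
    iexp (\<theta> * b) * exp (complex_of_real (t - s) * (iexp (\<theta> * a) - 1))"
proof -
  have inc: "(\<lambda>\<omega>. N i t \<omega> - N i s \<omega>) \<in> M \<rightarrow>\<^sub>M count_space UNIV"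
    using N_measurable i st by (intro measurable_diff_nat) auto
  have meas: "(\<lambda>\<omega>. a * real (N i t \<omega> - N i s \<omega>) + b) \<in> borel_measurable M"
    using measurable_compose[OF inc, of "\<lambda>k. a * real k + b" borel] by simp
  have "char (distr M borel (\<lambda>\<omega>. a * real (N i t \<omega> - N i s \<omega>) + b)) \<theta> =
      (\<integral>\<omega>. iexp (\<theta> * (a * real (N i t \<omega> - N i s \<omega>) + b)) \<partial>M)"
    unfolding char_def by (subst integral_distr) (use meas in auto)
  also have "\<dots> = (\<integral>\<omega>. iexp (\<theta> * b) * iexp ((\<theta> * a) * real (N i t \<omega> - N i s \<omega>)) \<partial>M)"
    by (simp add: exp_add[symmetric] algebra_simps)
  also have "\<dots> = iexp (\<theta> * b) * (\<integral>\<omega>. iexp ((\<theta> * a) * real (N i t \<omega> - N i s \<omega>)) \<partial>M)"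
    by simp
  also have "(\<integral>\<omega>. iexp ((\<theta> * a) * real (N i t \<omega> - N i s \<omega>)) \<partial>M) =
      (\<integral>k. iexp ((\<theta> * a) * real k) \<partial>distr M (count_space UNIV) (\<lambda>\<omega>. N i t \<omega> - N i s \<omega>))"
    by (subst integral_distr[OF inc]) auto
  also have "\<dots> = exp (complex_of_real (t - s) * (iexp (\<theta> * a) - 1))"
    unfolding distr_increment[OF i st] using st by (intro poisson_characteristic_function) simp
  finally show ?thesis .
qed

text \<open>Product of the characteristic functions of three independent Poisson variables.\<close>

lemma char_scaled_displacement:
  fixes x t \<theta> :: real
  assumes x: "0 < x" and t: "0 < t"
  defines "u \<equiv> \<theta> / sqrt (2 * t)"
  shows "char (distr M borel (scaled_displacement x t)) \<theta> =
    exp (complex_of_real ((2 * t + x * sqrt t) * (cos u - 1)) + \<i> * complex_of_real (x * sqrt t * (u - sin u)))"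
proof -
  define s where "s = x * sqrt t"
  define a where "a = 1 / sqrt (2 * t)"
  have s: "0 < s" using x t by (simp add: s_def)
  let ?P = "PiM {0..} (\<lambda>_. count_space UNIV) :: (real \<Rightarrow> nat) measure"
  define Y where "Y i f = (if i = 1 then a * real (f t - f 0) + 0 else if i = 2 then - a * real (f t - f 0) + 0
      else - a * real (f (t + s) - f t) + a * s)" for i :: nat and f :: "real \<Rightarrow> nat"
  \<comment> \<open>Each summand is a function of a single clock, so independence is inherited from the clocks.\<close>
  define X where "X i \<omega> = Y i (\<lambda>r\<in>{0..}. N i r \<omega>)" for i \<omega>
  have "indep_vars (\<lambda>_. ?P) (\<lambda>i \<omega>. \<lambda>r\<in>{0..}. N i r \<omega>) {1, 2, 3}"
    using indep_clocks unfolding indep_processes_def by (rule indep_vars_subset) auto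
  then have X_indep: "indep_vars (\<lambda>_. borel) X {1, 2, 3}"
    unfolding X_def
  proof (rule indep_vars_compose2)
    have [measurable]: "(\<lambda>f. f r) \<in> ?P \<rightarrow>\<^sub>M count_space UNIV" if "0 \<le> r" for r
      using that by (intro measurable_component_singleton) auto
    have [measurable]: "(\<lambda>f. f r - f r') \<in> ?P \<rightarrow>\<^sub>M count_space UNIV" if "0 \<le> r" "0 \<le> r'" for r r'
      using that by (intro measurable_diff_nat) auto
    have "(\<lambda>f. b * real (f r - f r') + d) \<in> borel_measurable ?P" if "0 \<le> r" "0 \<le> r'" for r r' b d
      using that by measurable
    then show "Y i \<in> borel_measurable ?P" for i
      unfolding Y_def using s t by (cases "i = 1"; cases "i = 2") simp_all
  qed
  have sum_X: "distr M borel (\<lambda>\<omega>. \<Sum>i\<in>{1, 2, 3}. X i \<omega>) = distr M borel (scaled_displacement x t)"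
  proof (rule distr_cong[OF refl refl])
    fix \<omega> assume \<omega>: "\<omega> \<in> space M"
    have "N 3 t \<omega> \<le> N 3 (t + s) \<omega>" using N_mono[OF \<omega>, of 3 t "t + s"] s t by simp
    moreover have "scaled_displacement x t \<omega> = a * (real_of_int (displacement t s \<omega>) + s)"
      by (simp add: scaled_displacement_def a_def s_def)
    ultimately show "(\<Sum>i\<in>{1, 2, 3}. X i \<omega>) = scaled_displacement x t \<omega>"
      using s t N_0[OF \<omega>, of 1] N_0[OF \<omega>, of 2]
      by (simp add: X_def Y_def displacement_def of_nat_diff algebra_simps)
  qed
  have X: "X 1 = (\<lambda>\<omega>. a * real (N 1 t \<omega> - N 1 0 \<omega>) + 0)"
    "X 2 = (\<lambda>\<omega>. - a * real (N 2 t \<omega> - N 2 0 \<omega>) + 0)"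
    "X 3 = (\<lambda>\<omega>. - a * real (N 3 (t + s) \<omega> - N 3 t \<omega>) + a * s)"
    using t s by (auto simp: X_def Y_def fun_eq_iff)
  have char_X:
    "char (distr M borel (X 1)) \<theta> = iexp (\<theta> * 0) * exp (complex_of_real (t - 0) * (iexp (\<theta> * a) - 1))"
    "char (distr M borel (X 2)) \<theta> = iexp (\<theta> * 0) * exp (complex_of_real (t - 0) * (iexp (\<theta> * - a) - 1))"
    "char (distr M borel (X 3)) \<theta> =
      iexp (\<theta> * (a * s)) * exp (complex_of_real (t + s - t) * (iexp (\<theta> * - a) - 1))"
    unfolding X by (rule char_scaled_increment; use t s in simp)+
  have "char (distr M borel (scaled_displacement x t)) \<theta> = (\<Prod>i\<in>{1, 2, 3}. char (distr M borel (X i)) \<theta>)"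
    using char_distr_sum[OF X_indep, of \<theta>] unfolding sum_X .
  also have "\<dots> = char (distr M borel (X 1)) \<theta> *
      (char (distr M borel (X 2)) \<theta> * char (distr M borel (X 3)) \<theta>)" by simp
  also have "\<dots> = exp (complex_of_real t * (iexp u - 1) + complex_of_real t * (iexp (- u) - 1) +
      (\<i> * complex_of_real (s * u) + complex_of_real s * (iexp (- u) - 1)))"
  proof -
    have "\<theta> * a = u" "\<theta> * - a = - u" "\<theta> * (a * s) = s * u" "t - 0 = t" "t + s - t = s"
      by (simp_all add: u_def a_def)
    then show ?thesis unfolding char_X exp_add by (simp only:) (simp add: mult.assoc)
  qed
  also have "complex_of_real t * (iexp u - 1) + complex_of_real t * (iexp (- u) - 1) +
      (\<i> * complex_of_real (s * u) + complex_of_real s * (iexp (- u) - 1)) =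
      complex_of_real ((2 * t + s) * (cos u - 1)) + \<i> * complex_of_real (s * (u - sin u))"
    by (simp add: complex_eq_iff Re_exp Im_exp algebra_simps)
  finally show ?thesis by (simp add: s_def)
qed

lemma scaled_displacement_measurable:
  assumes "0 \<le> x" "0 \<le> t"
  shows "scaled_displacement x t \<in> borel_measurable M"
proof -
  have [measurable]: "N 1 t \<in> M \<rightarrow>\<^sub>M count_space UNIV" "N 2 t \<in> M \<rightarrow>\<^sub>M count_space UNIV"
    "N 3 (t + x * sqrt t) \<in> M \<rightarrow>\<^sub>M count_space UNIV" "N 3 t \<in> M \<rightarrow>\<^sub>M count_space UNIV"
    using assms by (auto intro!: N_measurable)
  show ?thesis unfolding scaled_displacement_def[abs_def] displacement_def by measurable
qed

lemma scaled_displacement_clt: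
  assumes x: "0 < x" and T: "filterlim T at_top sequentially" "\<And>n. 0 < T n"
  shows "weak_conv_m (\<lambda>n. distr M borel (scaled_displacement x (T n))) std_normal_distribution"
proof (rule levy_continuity)
  show "real_distribution (distr M borel (scaled_displacement x (T n)))" for n
    using x T(2)[of n] by (intro real_distribution_distr scaled_displacement_measurable) auto
  show "real_distribution std_normal_distribution" by (rule real_dist_normal_dist)
  fix \<theta>
  let ?u = "\<lambda>t. \<theta> / sqrt (2 * t)"
  have "((\<lambda>t. exp (complex_of_real ((2 * t + x * sqrt t) * (cos (?u t) - 1)) +
      \<i> * complex_of_real (x * sqrt t * (?u t - sin (?u t)))))
    \<longlongrightarrow> exp (complex_of_real (- \<theta>\<^sup>2 / 2) + \<i> * complex_of_real 0)) at_top"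
    by (intro tendsto_exp tendsto_add tendsto_mult tendsto_const tendsto_of_real
        limit_exponent_re limit_exponent_im)
  from filterlim_compose[OF this T(1)]
  have "(\<lambda>n. char (distr M borel (scaled_displacement x (T n))) \<theta>) \<longlonglongrightarrow>
      exp (complex_of_real (- \<theta>\<^sup>2 / 2) + \<i> * complex_of_real 0)"
    using char_scaled_displacement[OF x T(2)] by simp
  then show "(\<lambda>n. char (distr M borel (scaled_displacement x (T n))) \<theta>) \<longlonglongrightarrow> char std_normal_distribution \<theta>"
    by (simp add: char_std_normal_distribution exp_of_real[symmetric])
qed

theorem prob_label_unchanged_tendsto:
  assumes x: "0 < x" and T: "filterlim T at_top sequentially"
  shows "(\<lambda>n. prob {\<omega>\<in>space M. osp_label N (T n) \<omega> 1 = osp_label N (T n + x * sqrt (T n)) \<omega> 1})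
    \<longlonglongrightarrow> 2 * measure std_normal_distribution {x / sqrt 2..}"
proof -
  \<comment> \<open>The continuity theorem needs genuine laws for all \<open>n\<close>, also where \<open>T n\<close> is not positive.\<close>
  define S where "S n = max 1 (T n)" for n
  have ev: "\<forall>\<^sub>F n in sequentially. S n = T n"
    using T unfolding filterlim_at_top by (auto simp: S_def elim!: allE[of _ 1] eventually_mono)
  have S: "filterlim S at_top sequentially" "\<And>n. 0 < S n"
  proof -
    show "filterlim S at_top sequentially"
      using T ev by (subst filterlim_cong[OF refl refl]) auto
    show "0 < S n" for n by (simp add: S_def less_max_iff_disj)
  qed
  let ?D = "\<lambda>n. distr M borel (scaled_displacement x (S n))"
  have distr: "real_distribution (?D n)" for n
    using x S(2)[of n] by (intro real_distribution_distr scaled_displacement_measurable) auto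
  let ?y = "x / sqrt 2"
  have lim: "(\<lambda>n. measure (?D n) A) \<longlonglongrightarrow> measure std_normal_distribution A"
    if "A \<in> sets borel" "frontier A \<subseteq> {?y}" for A
  proof (rule weak_conv_imp_continuity_set_conv[OF distr real_dist_normal_dist])
    show "weak_conv_m ?D std_normal_distribution" using x S by (rule scaled_displacement_clt)
    have "emeasure std_normal_distribution {?y} = 0"
      by (subst emeasure_density) (auto simp: nn_integral_indicator_singleton)
    then have "emeasure std_normal_distribution (frontier A) \<le> 0"
      using emeasure_mono[OF that(2), of std_normal_distribution] by simp
    then show "emeasure std_normal_distribution (frontier A) = 0" by simp
  qed (use that in auto)
  have "(\<lambda>n. measure (?D n) {?y..} + measure (?D n) {?y<..}) \<longlonglongrightarrow>
      measure std_normal_distribution {?y..} + measure std_normal_distribution {?y<..}"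
    by (intro tendsto_add lim) (auto simp: frontier_def interior_open)
  also have "measure std_normal_distribution {?y..} + measure std_normal_distribution {?y<..} =
      2 * measure std_normal_distribution {?y..}"
    by (simp add: std_normal_tail_open)
  finally have "(\<lambda>n. measure (?D n) {?y..} + measure (?D n) {?y<..}) \<longlonglongrightarrow>
      2 * measure std_normal_distribution {?y..}" .
  moreover have "measure (?D n) {?y..} + measure (?D n) {?y<..} =
    prob {\<omega>\<in>space M. osp_label N (S n) \<omega> 1 = osp_label N (S n + x * sqrt (S n)) \<omega> 1}" for n
  proof -
    let ?s = "x * sqrt (S n)"
    have meas: "scaled_displacement x (S n) \<in> borel_measurable M"
      using x S(2)[of n] by (intro scaled_displacement_measurable) auto
    have "sqrt (2 * S n) > 0" using S(2)[of n] by simp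
    moreover have "?y = ?s / sqrt (2 * S n)" using S(2)[of n] by (simp add: real_sqrt_mult)
    ultimately have "?y \<le> scaled_displacement x (S n) \<omega> \<longleftrightarrow> 0 \<le> displacement (S n) ?s \<omega>"
      "?y < scaled_displacement x (S n) \<omega> \<longleftrightarrow> 0 < displacement (S n) ?s \<omega>" for \<omega>
      unfolding scaled_displacement_def by (simp_all add: divide_le_cancel divide_less_cancel)
    then have "measure (?D n) {?y..} = prob {\<omega>\<in>space M. 0 \<le> displacement (S n) ?s \<omega>}"
      "measure (?D n) {?y<..} = prob {\<omega>\<in>space M. 0 < displacement (S n) ?s \<omega>}"
      using meas by (auto simp: measure_distr intro!: arg_cong[where f=prob])
    then show ?thesis using prob_label_unchanged[of "S n" ?s] S(2)[of n] x by simp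
  qed
  ultimately have "(\<lambda>n. prob {\<omega>\<in>space M. osp_label N (S n) \<omega> 1 = osp_label N (S n + x * sqrt (S n)) \<omega> 1})
    \<longlonglongrightarrow> 2 * measure std_normal_distribution {?y..}" by simp
  then show ?thesis
    by (rule Lim_transform_eventually) (use ev in eventually_elim, simp)
qed

text \<open>The exceptional null set does not depend on \<open>s\<close>, so that this also covers the event
  that the waiting time is infinite.\<close>

lemma AE_tau_le_iff:
  assumes "0 \<le> t"
  shows "AE \<omega> in M. \<forall>s\<ge>0. (osp_tau N t \<omega> \<le> ereal s \<longleftrightarrow>
    osp_label N t \<omega> 1 \<noteq> osp_label N (t + s) \<omega> 1)"
  using AE_silent_pair AE_space
proof eventually_elim
  case (elim \<omega>)
  show ?case
  proof (intro allI impI)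
    fix s :: real assume s: "0 \<le> s"
    obtain n where "1 \<le> n" "N n (t + s) \<omega> = 0" using elim assms s by (meson add_nonneg_nonneg)
    then have "osp_label N t \<omega> 1 \<le> osp_label N (t + s) \<omega> 1"
      using osp_label_mono[OF clock_paths[OF elim(2)], of n "t + s" t] assms s by simp
    moreover have "osp_tau N t \<omega> \<le> ereal s \<longleftrightarrow> osp_label N t \<omega> 1 < osp_label N (t + s) \<omega> 1"
      using elim assms s by (intro osp_tau_le_iff clock_paths) auto
    ultimately show "osp_tau N t \<omega> \<le> ereal s \<longleftrightarrow> osp_label N t \<omega> 1 \<noteq> osp_label N (t + s) \<omega> 1"
      by auto
  qed
qed

text \<open>If the label never changes after \<open>t\<close>, then it does not change in \<open>(r, r + x * sqrt r]\<close> for any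
  \<open>r \<ge> t\<close>. Letting first \<open>r\<close> and then \<open>x\<close> tend to infinity, the probability of this vanishes.\<close>

theorem AE_tau_finite:
  assumes t: "0 \<le> t"
  shows "AE \<omega> in M. osp_tau N t \<omega> < \<infinity>"
proof -
  let ?F = "{\<omega>\<in>space M. osp_tau N t \<omega> = \<infinity>}"
  have F: "?F \<in> events"
  proof -
    have [measurable]: "osp_tau N t \<in> borel_measurable M" by (rule osp_tau_measurable[OF t])
    show ?thesis by measurable
  qed
  have bound: "prob ?F \<le> 2 * measure std_normal_distribution {x / sqrt 2..}" if x: "0 < x" for x
  proof (rule LIMSEQ_le_const)
    show "(\<lambda>n. prob {\<omega>\<in>space M. osp_label N (t + real (Suc n)) \<omega> 1 =
        osp_label N (t + real (Suc n) + x * sqrt (t + real (Suc n))) \<omega> 1})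
      \<longlonglongrightarrow> 2 * measure std_normal_distribution {x / sqrt 2..}"
      by (rule prob_label_unchanged_tendsto[OF x]) real_asymp
    show "\<exists>n0. \<forall>n\<ge>n0. prob ?F \<le> prob {\<omega>\<in>space M. osp_label N (t + real (Suc n)) \<omega> 1 =
        osp_label N (t + real (Suc n) + x * sqrt (t + real (Suc n))) \<omega> 1}"
    proof (intro exI[of _ 0] allI impI finite_measure_mono_AE)
      fix n
      let ?r = "real (Suc n)" and ?s = "x * sqrt (t + real (Suc n))"
      have "0 \<le> ?s" using x t by simp
      show "AE \<omega> in M. \<omega> \<in> ?F \<longrightarrow> \<omega> \<in> {\<omega>\<in>space M. osp_label N (t + ?r) \<omega> 1 = osp_label N (t + ?r + ?s) \<omega> 1}"
        using AE_tau_le_iff[OF t] AE_space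
      proof eventually_elim
        case (elim \<omega>)
        show ?case
        proof
          assume "\<omega> \<in> ?F"
          then have "osp_label N t \<omega> 1 = osp_label N (t + s) \<omega> 1" if "0 \<le> s" for s
            using elim(1)[rule_format, OF that] by auto
          from this[of ?r] this[of "?r + ?s"] \<open>0 \<le> ?s\<close> elim(2)
          show "\<omega> \<in> {\<omega>\<in>space M. osp_label N (t + ?r) \<omega> 1 = osp_label N (t + ?r + ?s) \<omega> 1}"
            by (simp add: add.assoc)
        qed
      qed
      have "{\<omega>\<in>space M. osp_label N u \<omega> 1 = osp_label N v \<omega> 1} \<in> events" if "0 \<le> u" "0 \<le> v" for u v
        using that by (rule sets_label_eq)
      then show "{\<omega>\<in>space M. osp_label N (t + ?r) \<omega> 1 = osp_label N (t + ?r + ?s) \<omega> 1} \<in> events"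
        using t \<open>0 \<le> ?s\<close> by simp
    qed
  qed
  have "prob ?F \<le> 0"
  proof (rule tendsto_lowerbound)
    interpret normal: real_distribution std_normal_distribution by (rule real_dist_normal_dist)
    have "measure std_normal_distribution {x / sqrt 2..} = 1 - cdf std_normal_distribution (x / sqrt 2)" for x
    proof -
      have "measure std_normal_distribution {x / sqrt 2<..} = 1 - cdf std_normal_distribution (x / sqrt 2)"
        unfolding cdf_def using normal.prob_compl[of "{..x / sqrt 2}"]
        by (simp add: Compl_eq_Diff_UNIV[symmetric] flip: Compl_atMost)
      then show ?thesis by (simp add: std_normal_tail_open)
    qed
    moreover have "((\<lambda>x. 2 * (1 - cdf std_normal_distribution (x / sqrt 2))) \<longlongrightarrow> 2 * (1 - 1)) at_top"
    proof (intro tendsto_intros filterlim_compose[OF normal.cdf_lim_at_top_prob])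
      show "filterlim (\<lambda>x::real. x / sqrt 2) at_top at_top" by real_asymp
    qed
    ultimately show "((\<lambda>x. 2 * measure std_normal_distribution {x / sqrt 2..}) \<longlongrightarrow> 0) at_top" by simp
    show "\<forall>\<^sub>F x in at_top. prob ?F \<le> 2 * measure std_normal_distribution {x / sqrt 2..}"
      using eventually_gt_at_top[of 0] by eventually_elim (rule bound)
  qed simp
  then have "?F \<in> null_sets M"
    using F by (simp add: null_sets_def emeasure_eq_measure measure_le_0_iff)
  then show ?thesis by (rule AE_I') auto
qed

theorem tau_weak_convergence:
  assumes T: "filterlim T at_top sequentially"
  shows "weak_conv_m
    (\<lambda>n. distr M borel (\<lambda>\<omega>. real_of_ereal (osp_tau N (T n) \<omega>) / sqrt (T n))) abs_gaussian_var2"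
  unfolding weak_conv_m_def weak_conv_def
proof (intro allI impI)
  fix x
  let ?F = "\<lambda>n. cdf (distr M borel (\<lambda>\<omega>. real_of_ereal (osp_tau N (T n) \<omega>) / sqrt (T n))) x"
  have T_pos: "\<forall>\<^sub>F n in sequentially. 0 < T n"
    using T unfolding filterlim_at_top_dense by blast
  have F: "?F n = prob {\<omega>\<in>space M. real_of_ereal (osp_tau N (T n) \<omega>) / sqrt (T n) \<le> x}"
    if "0 < T n" for n
  proof -
    have "osp_tau N (T n) \<in> borel_measurable M" using that by (intro osp_tau_measurable) auto
    then have "(\<lambda>\<omega>. real_of_ereal (osp_tau N (T n) \<omega>) / sqrt (T n)) \<in> borel_measurable M" by measurable
    then show ?thesis unfolding cdf_def
      by (subst measure_distr) (auto intro!: arg_cong[where f=prob])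
  qed
  show "?F \<longlonglongrightarrow> cdf abs_gaussian_var2 x"
  proof (cases "x < 0")
    case True
    have "\<forall>\<^sub>F n in sequentially. 0 = ?F n"
      using T_pos
    proof eventually_elim
      case (elim n)
      have "\<not> real_of_ereal (osp_tau N (T n) \<omega>) / sqrt (T n) \<le> x" for \<omega>
      proof -
        have "0 \<le> real_of_ereal (osp_tau N (T n) \<omega>) / sqrt (T n)"
          using elim by (intro divide_nonneg_nonneg real_of_ereal_pos osp_tau_nonneg) auto
        with True show ?thesis by linarith
      qed
      then show ?case by (simp add: F[OF elim])
    qed
    then have "?F \<longlonglongrightarrow> 0" by (rule Lim_transform_eventually[OF tendsto_const])
    with True show ?thesis by (simp add: cdf_abs_gaussian_var2)
  next
    case False
    have F_eq: "?F n = 1 - prob {\<omega>\<in>space M. osp_label N (T n) \<omega> 1 = osp_label N (T n + x * sqrt (T n)) \<omega> 1}"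
      if n: "0 < T n" for n
    proof -
      let ?E = "{\<omega>\<in>space M. osp_label N (T n) \<omega> 1 = osp_label N (T n + x * sqrt (T n)) \<omega> 1}"
      have s: "0 \<le> x * sqrt (T n)" using False n by simp
      have E: "?E \<in> events" using n s by (intro sets_label_eq) auto
      have "prob {\<omega>\<in>space M. real_of_ereal (osp_tau N (T n) \<omega>) / sqrt (T n) \<le> x} = prob (space M - ?E)"
      proof (rule finite_measure_eq_AE)
        show "AE \<omega> in M. \<omega> \<in> {\<omega>\<in>space M. real_of_ereal (osp_tau N (T n) \<omega>) / sqrt (T n) \<le> x} \<longleftrightarrow>
            \<omega> \<in> space M - ?E"
          using AE_tau_le_iff[OF less_imp_le[OF n]] AE_tau_finite[OF less_imp_le[OF n]] AE_space
        proof eventually_elim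
          case (elim \<omega>)
          obtain r where r: "osp_tau N (T n) \<omega> = ereal r"
            using elim osp_tau_nonneg[of N "T n" \<omega>] by (cases "osp_tau N (T n) \<omega>") auto
          have "real_of_ereal (osp_tau N (T n) \<omega>) / sqrt (T n) \<le> x \<longleftrightarrow> osp_tau N (T n) \<omega> \<le> ereal (x * sqrt (T n))"
            using n by (simp add: r pos_divide_le_eq)
          also have "\<dots> \<longleftrightarrow> \<omega> \<notin> ?E" using elim s by auto
          finally show ?case using elim by simp
        qed
        have "osp_tau N (T n) \<in> borel_measurable M" using n by (intro osp_tau_measurable) auto
        then show "{\<omega>\<in>space M. real_of_ereal (osp_tau N (T n) \<omega>) / sqrt (T n) \<le> x} \<in> events" by measurable
      qed (use E in auto)
      then show ?thesis using E by (simp add: F[OF n] prob_compl)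
    qed
    show ?thesis
    proof (cases "x = 0")
      case True
      have "\<forall>\<^sub>F n in sequentially. 0 = ?F n"
        using T_pos
      proof eventually_elim
        case (elim n)
        show ?case using F_eq[OF elim] True by (simp add: prob_space)
      qed
      then have "?F \<longlonglongrightarrow> 0" by (rule Lim_transform_eventually[OF tendsto_const])
      moreover have "cdf abs_gaussian_var2 0 = 0"
        using std_normal_interval[of 0] std_normal_atomless[of 0] by (simp add: cdf_abs_gaussian_var2)
      ultimately show ?thesis using True by simp
    next
      case False
      with \<open>\<not> x < 0\<close> have x: "0 < x" by simp
      have "\<forall>\<^sub>F n in sequentially.
          1 - prob {\<omega>\<in>space M. osp_label N (T n) \<omega> 1 = osp_label N (T n + x * sqrt (T n)) \<omega> 1} = ?F n"
        using T_pos by eventually_elim (simp add: F_eq)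
      then have "?F \<longlonglongrightarrow> 1 - 2 * measure std_normal_distribution {x / sqrt 2..}"
        by (rule Lim_transform_eventually[OF tendsto_diff[OF tendsto_const prob_label_unchanged_tendsto[OF x T]]])
      with x show ?thesis by (simp add: cdf_abs_gaussian_var2)
    qed
  qed
qed

end

theorem theorem1p5:
  fixes M :: "'a measure" and N :: "nat \<Rightarrow> real \<Rightarrow> 'a \<Rightarrow> nat"
  assumes "prob_space M"
    and "\<And>i. 1 \<le> i \<Longrightarrow> poisson_process M 1 (N i)"
    and "indep_processes M N {1..}"
  shows "(\<forall>t\<ge>0. AE \<omega> in M. osp_tau N t \<omega> < \<infinity>) \<and>
    (\<forall>T :: nat \<Rightarrow> real. filterlim T at_top sequentially \<longrightarrow>
       weak_conv_m
         (\<lambda>n. distr M borel (\<lambda>\<omega>. real_of_ereal (osp_tau N (T n) \<omega>) / sqrt (T n)))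
         abs_gaussian_var2)"
proof -
  interpret poisson_clocks M N
    using assms by (simp add: poisson_clocks_def poisson_clocks_axioms_def)
  show ?thesis using AE_tau_finite tau_weak_convergence by blast
qed

end
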